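(* Let the game, the sets $X_i$, $\Theta$, the functions $f_i$, the communication graph, the functions $\hat{\mathbf F}$, $\hat F$, $\hat\chi_\Theta$, the constants $L_x$, $L_F$, $\xi>0$, and the optimal value $\hat{\mathbf F}^*$ be as in the context, with Assumptions 1, 2 and 3 listed there. Let $\{\theta_k\}$ be the sequence generated by the inexact zeroth-order algorithm described in the context with constant stepsize $\alpha>0$ and inexactness levels $\varepsilon_k$. If $\alpha\le \frac{\xi}{4(nNL_F+1)}$, then for every integer $K\ge 1$, $$\frac1K\sum_{k=0}^{K-1}\mathrm{E}\big[\|\nabla\hat{\mathbf F}(\theta_k)\|^2\big]\le \frac{4(\hat{\mathbf F}(\theta_0)-\hat{\mathbf F}^* )}{\alpha K}+8N^2n^2L_F^2\,\alpha\,\frac{nNL_F+1}{\xi}+\frac{20N^2L_x^2n^2\sum_{k=0}^{K-1}\varepsilon_k}{\xi^2K}.$$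
   Context: **Game.** There are $N$ players. Player $i\in[N]:=\{1,\dots,N\}$ chooses $x_i\in X_i\subseteq\mathbb R^{d_i}$; $d=\sum_i d_i$, $X=X_1\times\cdots\times X_N\subseteq\mathbb R^d$, $x=(x_i)_{i\in[N]}$, $x_{-i}=(x_j)_{j\ne i}$. Given a regulator decision $\theta\in\mathbb R^n$, player $i$ has real-valued cost $f_i(x_i,x_{-i},\theta)=f_i(x,\theta)$. A point $x(\theta)\in X$ is a Nash equilibrium (NE) for $\theta$ if $f_i(x_i(\theta),x_{-i}(\theta),\theta)\le f_i(x_i,x_{-i}(\theta),\theta)$ for all $x_i\in X_i$, $i\in[N]$. The pseudo-gradient is $G(x,\theta)=(\nabla_{x_i}f_i(x_i,x_{-i},\theta))_{i\in[N]}\in\mathbb R^d$. The regulator's feasible set is $\Theta\subseteq\mathbb R^n$. Norms are Euclidean. **Assumption 1.** (i) Each $X_i$ is nonempty, compact, convex. (ii) $\Theta$ is nonempty, closed, convex. (iii) For each $i$, $f_i(x_i,x_{-i},\theta)$ is continuously differentiable and convex in $x_i$ for any $x_{-i}\in\mathbb R^{d-d_i}$, $\theta\in\mathbb R^n$. (iv) There is $L_\theta>0$ with $|f_i(x,\theta)-f_i(x,\theta')|\le L_\theta\|\theta-\theta'\|$ for all $i$, $x\in X$, $\theta,\theta'\in\mathbb R^n$. Moreover there is a constant $L_x>0$ with $|f_i(x,\theta)-f_i(x',\theta)|\le L_x\|x-x'\|$ for all $i$, $x,x'\in X$, $\theta\in\mathbb R^n$. **Assumption 2.** (i) There are $\mu,l>0$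 such that for all $\theta\in\mathbb R^n$, $x,x'\in\mathbb R^d$: $(G(x,\theta)-G(x',\theta))^\top(x-x')\ge\mu\|x-x'\|^2$ and $\|G(x,\theta)-G(x',\theta)\|\le l\|x-x'\|$. (ii) There is $l_\theta>0$ with $\|G(x,\theta)-G(x,\theta')\|\le l_\theta\|\theta-\theta'\|$ for all $x\in X$, $\theta,\theta'\in\mathbb R^n$. Under these assumptions the NE $x(\theta)$ exists and is unique for every $\theta\in\mathbb R^n$. **Assumption 3.** The players communicate over a directed graph on $[N]$ with adjacency matrix $\mathcal A=[a_{ij}]\in\mathbb R^{N\times N}$, where $a_{ij}>0$ if $(j,i)$ is an edge or $i=j$, and $a_{ij}=0$ otherwise. The graph is strongly connected and $\mathcal A$ is doubly stochastic. **Objectives.** $F_i(\theta):=f_i(x(\theta),\theta)$, $F:=\sum_{i=1}^NF_i$. $L_F>0$ is a constant with $|F_i(\theta)-F_i(\theta')|\le L_F\|\theta-\theta'\|$ for all $i\in[N]$, $\theta,\theta'\in\mathbb R^n$. For a fixed smoothing parameter $\xi>0$: $\hat F(\theta):=\sum_{i=1}^N\mathrm E_\nu[F_i(\theta+\xi\nu)]$ with $\nu$ uniform on the closed unit ball of $\mathbb R^n$; $\hat\chi_\Theta(\theta):=\frac1{2\xi}\mathrm{dist}^2(\theta,\Theta)$, so $\nabla\hat\chi_\Theta(\theta)=\frac1\xi(\theta-\Pi_\Theta(\theta))$ with $\Pi_\Theta$ the Euclidean projection; $\hat{\mathbf F}:=\hat F+\hat\chi_\Theta$; $\hat{\mathbf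 F}^*:=\min_{\theta\in\mathbb R^n}\hat{\mathbf F}(\theta)$, which is assumed to exist. **Algorithm.** Start from a deterministic $\theta_0\in\Theta$. For $k=0,1,\dots,K-1$: draw $u_k$ uniformly from the unit sphere $\mathbb S^n=\{u\in\mathbb R^n:\|u\|=1\}$, independently of the past; for each $\tilde\theta_k\in\{\theta_k+\xi u_k,\theta_k\}$ obtain an approximate NE $x_{\varepsilon_k}(\tilde\theta_k)\in X$ from the inner routine below; set $$\hat\nabla_{\varepsilon_k}F(\theta_k)=\sum_{i=1}^N\frac n\xi\big(f_i(x_{\varepsilon_k}(\theta_k+\xi u_k),\theta_k+\xi u_k)-f_i(x_{\varepsilon_k}(\theta_k),\theta_k)\big)u_k,$$ $$\theta_{k+1}=\theta_k-\alpha\Big(\hat\nabla_{\varepsilon_k}F(\theta_k)+\frac1\xi(\theta_k-\Pi_\Theta(\theta_k))\Big).$$ *Inner routine* (stepsize $\gamma>0$, $t_k$ iterations). Each player $i$ holds $\mathbf x_{i,t}=(\mathbf x_{i,t}^j)_{j\in[N]}\in\mathbb R^d$, where $\mathbf x_{i,t}^i=x_{i,t}$ is its own strategy and $\mathbf x_{i,t}^j$ its estimate of player $j$'s strategy; the fixed initialization has $x_{i,0}\in X_i$, $\mathbf x_{i,0}^{-i}\in\mathbb R^{d-d_i}$. For $t=0,\dots,t_k-1$: $\hat{\mathbf x}_{i,t}=\sum_ja_{ij}\mathbf x_{j,t}$, $x_{i,t+1}=\Pi_{X_i}[\hat{\mathbf x}_{i,t}^i-\gamma\nabla_{x_i}f_i(\hat{\mathbf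 x}_{i,t},\tilde\theta_k)]$, $\mathbf x_{i,t+1}^{-i}=\hat{\mathbf x}_{i,t}^{-i}$. Output $x_{\varepsilon_k}(\tilde\theta_k)=(x_{i,t_k})_{i\in[N]}$. *Inexactness level.* $\varepsilon_k\ge0$ is a deterministic number such that $\|x_{\varepsilon_k}(\tilde\theta_k)-x(\tilde\theta_k)\|^2\le\varepsilon_k$ (almost surely) for both $\tilde\theta_k=\theta_k+\xi u_k$ and $\tilde\theta_k=\theta_k$. *)

theory Defs
  imports "HOL-Probability.Probability"
begin

definition gradient :: "('a::real_inner \<Rightarrow> real) \<Rightarrow> 'a \<Rightarrow> 'a" where
  "gradient h x = (THE D. GDERIV h x :> D)"

text \<open>
  Players are the elements of a finite type \<open>'p\<close>.  Joint strategies live in \<open>real ^ 'd\<close>, and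
  \<open>own c\<close> is the player to whom coordinate \<open>c\<close> belongs.  The strategy space of player \<open>i\<close>, of
  dimension \<open>card {c. own c = i}\<close> (which may differ between players), is identified isometrically
  with the coordinate subspace below, so that a player's set of strategies is a subset of it.
\<close>

definition strategy_space :: "('d::finite \<Rightarrow> 'p) \<Rightarrow> 'p \<Rightarrow> (real ^ 'd) set" where
  "strategy_space own i = {x. \<forall>c. own c \<noteq> i \<longrightarrow> x $ c = 0}"

definition block :: "('d::finite \<Rightarrow> 'p) \<Rightarrow> 'p \<Rightarrow> real ^ 'd \<Rightarrow> real ^ 'd" where
  "block own i x = (\<chi> c. if own c = i then x $ c else 0)"

text \<open>The joint strategy \<open>(y\<^sub>i, x\<^sub>-\<^sub>i)\<close>: only the coordinates of \<open>y\<close> owned by \<open>i\<close> matter.\<close>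

definition deviate :: "('d::finite \<Rightarrow> 'p) \<Rightarrow> 'p \<Rightarrow> real ^ 'd \<Rightarrow> real ^ 'd \<Rightarrow> real ^ 'd" where
  "deviate own i y x = (\<chi> c. if own c = i then y $ c else x $ c)"

definition joint_strategies ::
    "('d::finite \<Rightarrow> 'p) \<Rightarrow> ('p \<Rightarrow> (real ^ 'd) set) \<Rightarrow> (real ^ 'd) set" where
  "joint_strategies own X = {x. \<forall>i. block own i x \<in> X i}"

definition is_nash ::
    "('d::finite \<Rightarrow> 'p) \<Rightarrow> ('p \<Rightarrow> (real ^ 'd) set) \<Rightarrow> ('p \<Rightarrow> real ^ 'd \<Rightarrow> 't \<Rightarrow> real) \<Rightarrow>
     't \<Rightarrow> real ^ 'd \<Rightarrow> bool" where
  "is_nash own X f \<theta> x \<longleftrightarrow>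
     x \<in> joint_strategies own X \<and> (\<forall>i. \<forall>y\<in>X i. f i x \<theta> \<le> f i (deviate own i y x) \<theta>)"

definition nash ::
    "('d::finite \<Rightarrow> 'p) \<Rightarrow> ('p \<Rightarrow> (real ^ 'd) set) \<Rightarrow> ('p \<Rightarrow> real ^ 'd \<Rightarrow> 't \<Rightarrow> real) \<Rightarrow>
     't \<Rightarrow> real ^ 'd" where
  "nash own X f \<theta> = (THE x. is_nash own X f \<theta> x)"

text \<open>
  The partial gradient of \<open>f i\<close> with respect to player \<open>i\<close>'s own strategy.  The differentiated
  function depends on \<open>y\<close> only through the coordinates owned by \<open>i\<close>, so its full gradient lies in
  \<open>strategy_space own i\<close>.
\<close>

definition partial_gradient ::
    "('d::finite \<Rightarrow> 'p) \<Rightarrow> ('p \<Rightarrow> real ^ 'd \<Rightarrow> 't \<Rightarrow> real) \<Rightarrow> 'p \<Rightarrow> real ^ 'd \<Rightarrow> 't \<Rightarrow> real ^ 'd" where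
  "partial_gradient own f i x \<theta> = gradient (\<lambda>y. f i (deviate own i y x) \<theta>) x"

definition pseudo_gradient ::
    "('d::finite \<Rightarrow> 'p) \<Rightarrow> ('p \<Rightarrow> real ^ 'd \<Rightarrow> 't \<Rightarrow> real) \<Rightarrow> real ^ 'd \<Rightarrow> 't \<Rightarrow> real ^ 'd" where
  "pseudo_gradient own f x \<theta> = (\<chi> c. partial_gradient own f (own c) x \<theta> $ c)"

definition doubly_stochastic :: "real ^ 'p ^ 'p \<Rightarrow> bool" where
  "doubly_stochastic A \<longleftrightarrow>
     (\<forall>i j. 0 \<le> A $ i $ j) \<and> (\<forall>i. (\<Sum>j\<in>UNIV. A $ i $ j) = 1) \<and> (\<forall>j. (\<Sum>i\<in>UNIV. A $ i $ j) = 1)"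

definition player_objective ::
    "('d::finite \<Rightarrow> 'p) \<Rightarrow> ('p \<Rightarrow> (real ^ 'd) set) \<Rightarrow> ('p \<Rightarrow> real ^ 'd \<Rightarrow> 't \<Rightarrow> real) \<Rightarrow>
     'p \<Rightarrow> 't \<Rightarrow> real" where
  "player_objective own X f i \<theta> = f i (nash own X f \<theta>) \<theta>"

definition smoothed_objective ::
    "('d::finite \<Rightarrow> 'p::finite) \<Rightarrow> ('p \<Rightarrow> (real ^ 'd) set) \<Rightarrow>
     ('p \<Rightarrow> real ^ 'd \<Rightarrow> real ^ 'n \<Rightarrow> real) \<Rightarrow> real \<Rightarrow> real ^ 'n \<Rightarrow> real" where
  "smoothed_objective own X f \<xi> \<theta> =
     (\<Sum>i\<in>UNIV. \<integral>\<nu>. player_objective own X f i (\<theta> + \<xi> *\<^sub>R \<nu>) \<partial>uniform_measure lborel (cball 0 1))"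

definition smoothed_indicator :: "(real ^ 'n) set \<Rightarrow> real \<Rightarrow> real ^ 'n \<Rightarrow> real" where
  "smoothed_indicator \<Theta> \<xi> \<theta> = (infdist \<theta> \<Theta>)\<^sup>2 / (2 * \<xi>)"

definition penalized_objective ::
    "('d::finite \<Rightarrow> 'p::finite) \<Rightarrow> ('p \<Rightarrow> (real ^ 'd) set) \<Rightarrow>
     ('p \<Rightarrow> real ^ 'd \<Rightarrow> real ^ 'n \<Rightarrow> real) \<Rightarrow> (real ^ 'n) set \<Rightarrow> real \<Rightarrow> real ^ 'n \<Rightarrow> real" where
  "penalized_objective own X f \<Theta> \<xi> \<theta> = smoothed_objective own X f \<xi> \<theta> + smoothed_indicator \<Theta> \<xi> \<theta>"

text \<open>
  Normalized surface measure of the unit sphere, in the polar-coordinate form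
  \<open>\<sigma>(B) = vol {r u | 0 < r \<le> 1, u \<in> B} / vol (cball 0 1)\<close>: the image of the uniform distribution on
  the unit ball under \<open>x \<mapsto> x / \<parallel>x\<parallel>\<close> (the value \<open>sgn 0 = 0\<close> is immaterial, \<open>{0}\<close> being a null set).
\<close>

definition uniform_sphere :: "(real ^ 'n) measure" where
  "uniform_sphere = distr (uniform_measure lborel (cball 0 1)) borel sgn"

text \<open>
  \<open>inner_iter \<dots> \<theta> t i\<close> is the vector held by player \<open>i\<close> after \<open>t\<close> rounds: its coordinates owned by \<open>i\<close>
  are the player's own strategy, those owned by \<open>j \<noteq> i\<close> are its estimate of the strategy of \<open>j\<close>.
\<close>

primrec inner_iter ::
    "('d::finite \<Rightarrow> 'p::finite) \<Rightarrow> ('p \<Rightarrow> (real ^ 'd) set) \<Rightarrow> ('p \<Rightarrow> real ^ 'd \<Rightarrow> 't \<Rightarrow> real) \<Rightarrow>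
     real ^ 'p ^ 'p \<Rightarrow> real \<Rightarrow> ('p \<Rightarrow> real ^ 'd) \<Rightarrow> 't \<Rightarrow> nat \<Rightarrow> 'p \<Rightarrow> real ^ 'd" where
  "inner_iter own X f A \<gamma> x0 \<theta> 0 = x0"
| "inner_iter own X f A \<gamma> x0 \<theta> (Suc t) = (\<lambda>i.
     let xh = (\<Sum>j\<in>UNIV. A $ i $ j *\<^sub>R inner_iter own X f A \<gamma> x0 \<theta> t j)
     in deviate own i
          (closest_point (X i) (block own i xh - \<gamma> *\<^sub>R partial_gradient own f i xh \<theta>)) xh)"

definition inner_output ::
    "('d::finite \<Rightarrow> 'p::finite) \<Rightarrow> ('p \<Rightarrow> (real ^ 'd) set) \<Rightarrow> ('p \<Rightarrow> real ^ 'd \<Rightarrow> 't \<Rightarrow> real) \<Rightarrow>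
     real ^ 'p ^ 'p \<Rightarrow> real \<Rightarrow> ('p \<Rightarrow> real ^ 'd) \<Rightarrow> nat \<Rightarrow> 't \<Rightarrow> real ^ 'd" where
  "inner_output own X f A \<gamma> x0 t \<theta> = (\<chi> c. inner_iter own X f A \<gamma> x0 \<theta> t (own c) $ c)"

text \<open>In the next two definitions \<open>xe\<close> is the map from a regulator decision to the approximate NE.\<close>

definition gradient_estimate ::
    "('p::finite \<Rightarrow> real ^ 'd \<Rightarrow> real ^ 'n \<Rightarrow> real) \<Rightarrow> real \<Rightarrow> (real ^ 'n \<Rightarrow> real ^ 'd) \<Rightarrow>
     real ^ 'n \<Rightarrow> real ^ 'n \<Rightarrow> real ^ 'n" where
  "gradient_estimate f \<xi> xe u \<theta> =
     (\<Sum>i\<in>UNIV. (real CARD('n) / \<xi> * (f i (xe (\<theta> + \<xi> *\<^sub>R u)) (\<theta> + \<xi> *\<^sub>R u) - f i (xe \<theta>) \<theta>)) *\<^sub>R u)"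

definition zo_step ::
    "('p::finite \<Rightarrow> real ^ 'd \<Rightarrow> real ^ 'n \<Rightarrow> real) \<Rightarrow> (real ^ 'n) set \<Rightarrow> real \<Rightarrow> real \<Rightarrow>
     (real ^ 'n \<Rightarrow> real ^ 'd) \<Rightarrow> real ^ 'n \<Rightarrow> real ^ 'n \<Rightarrow> real ^ 'n" where
  "zo_step f \<Theta> \<xi> \<alpha> xe u \<theta> =
     \<theta> - \<alpha> *\<^sub>R (gradient_estimate f \<xi> xe u \<theta> + (1 / \<xi>) *\<^sub>R (\<theta> - closest_point \<Theta> \<theta>))"

text \<open>The \<open>\<sigma>\<close>-algebra generated by \<open>\<theta> 0, \<dots>, \<theta> k\<close> and \<open>u 0, \<dots>, u (k - 1)\<close>.\<close>

definition past ::
    "'w measure \<Rightarrow> (nat \<Rightarrow> 'w \<Rightarrow> 'a::topological_space) \<Rightarrow> (nat \<Rightarrow> 'w \<Rightarrow> 'a) \<Rightarrow> nat \<Rightarrow> 'w set set" where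
  "past M \<theta> u k = sigma_sets (space M)
     ({\<theta> j -` B \<inter> space M | j B. j \<le> k \<and> B \<in> sets borel} \<union>
      {u j -` B \<inter> space M | j B. j < k \<and> B \<in> sets borel})"

end

(*
  The gradient of the ball average of a Lipschitz function H at theta is (n / xi) E[H(theta + xi u) u]
  with u uniform on the sphere, hence Lipschitz with constant n L / xi, and the estimator built from exact
  equilibria is unbiased. Inserting one step of the algorithm into the quadratic upper bound of the
  penalized objective and estimating the square of the inexactness error e by Young's inequality leaves a bound
  that is affine in the exact estimator, which may therefore be replaced by its mean, u_k being independent
  of theta_k. The bounds then telescope. The error is controlled by the Lipschitz dependence of the
  costs on the strategies, once the equilibrium is known to exist (Brouwer applied to the projected
  gradient map) and to be unique (strong monotonicity).
*)
theory Submission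
  imports Defs
begin

text \<open>The objective is only Lipschitz, so its ball average is differentiated by moving the
  translation from the objective to the averaging kernel. The obstacle in the stochastic part is
  measurability: none is established for the approximate equilibrium as a function of the decision.
  The inexactness error therefore enters only through an almost sure deterministic bound, and
  expectations are taken of continuous functions of \<open>\<theta> k\<close> and \<open>u k\<close>
  alone. The stepsize condition says that \<alpha> times the smoothness constant of the penalized
  objective is at most 1/4. Of the ideal decrease, \<alpha> times the squared gradient norm, one
  quarter pays for Young's inequality and at most one quarter for the curvature; \<alpha> / 2 is
  left.\<close>

section \<open>Differentiation of a convolution with a Lipschitz kernel\<close>

lemma lborel_integral_shift:
  fixes F :: "'a::euclidean_space \<Rightarrow> 'b::{banach,second_countable_topology}"
  assumes [measurable]: "F \<in> borel_measurable borel"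
  shows "(\<integral>y. F (c + y) \<partial>lborel) = (\<integral>y. F y \<partial>lborel)"
proof -
  have "(\<integral>y. F y \<partial>lborel) = (\<integral>y. F y \<partial>distr lborel borel ((+) c))"
    by (simp add: lborel_distr_plus)
  also have "\<dots> = (\<integral>y. F (c + y) \<partial>lborel)"
    by (rule integral_distr) simp_all
  finally show ?thesis ..
qed

lemma integrable_lborel_bounded_support:
  fixes F :: "'a::euclidean_space \<Rightarrow> 'b::{banach,second_countable_topology}"
  assumes "F \<in> borel_measurable borel"
    and "\<And>y. norm y \<le> R \<Longrightarrow> norm (F y) \<le> B" and "\<And>y. norm y > R \<Longrightarrow> F y = 0"
  shows "integrable lborel F"
  by (rule integrableI_bounded_set[where A = "cball 0 R" and B = B])
     (use assms emeasure_lborel_cball_finite[of 0 R] in \<open>auto simp: less_top\<close>)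

lemma continuous_bounded_on_cball:
  fixes H :: "'a::euclidean_space \<Rightarrow> real"
  assumes "continuous_on UNIV H"
  obtains B where "B > 0" "\<And>y. norm y \<le> R \<Longrightarrow> \<bar>H (t + y)\<bar> \<le> B"
proof -
  have "compact ((\<lambda>y. H (t + y)) ` cball 0 R)"
    by (intro compact_continuous_image continuous_on_compose2[OF assms] continuous_intros) auto
  then obtain B where "B > 0" "\<forall>x\<in>(\<lambda>y. H (t + y)) ` cball 0 R. norm x \<le> B"
    using compact_imp_bounded bounded_pos by metis
  then show thesis using that[of B] by auto
qed

text \<open>A translation of the integration variable moves the increment \<open>h\<close> from
  \<open>H\<close>, which is merely continuous, to the kernel \<open>k\<close>; the derivative then
  falls on \<open>k\<close>, with a minus sign. The difference quotients of \<open>k\<close> are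
  bounded and the supports are bounded, so dominated convergence works with a derivative of
  \<open>k\<close> that exists almost everywhere.\<close>

lemma GDERIV_convolution:
  fixes H k :: "'a::euclidean_space \<Rightarrow> real" and g :: "'a \<Rightarrow> 'a"
  assumes H: "continuous_on UNIV H"
    and k_lip: "\<And>x y. \<bar>k x - k y\<bar> \<le> C * norm (x - y)"
    and k_supp: "\<And>y. norm y > R \<Longrightarrow> k y = 0"
    and g_meas: "g \<in> borel_measurable borel"
    and g_bound: "\<And>y. norm (g y) \<le> C"
    and g_supp: "\<And>y. norm y > R \<Longrightarrow> g y = 0"
    and deriv: "AE y in lborel. GDERIV k y :> g y"
  shows "GDERIV (\<lambda>t. \<integral>y. k y * H (t + y) \<partial>lborel) t :> - (\<integral>y. H (t + y) *\<^sub>R g y \<partial>lborel)"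
proof -
  note [measurable] = g_meas
  have C: "C \<ge> 0" using g_bound[of 0] norm_ge_zero order_trans by blast
  have k_cont: "continuous_on UNIV k"
    by (rule lipschitz_on_continuous_on[where L = C]) (auto intro!: lipschitz_onI simp: dist_norm k_lip C)
  have [measurable]: "H \<in> borel_measurable borel" "k \<in> borel_measurable borel"
    using H k_cont by (auto intro: borel_measurable_continuous_onI)
  obtain B where B: "B > 0" "\<And>y. norm y \<le> R + 1 \<Longrightarrow> \<bar>H (t + y)\<bar> \<le> B"
    using continuous_bounded_on_cball[OF H] by metis
  \<comment> \<open>\<open>r h y\<close> is the first-order error of \<open>k\<close> at
    \<open>y\<close> in the direction \<open>- h\<close>, weighted by \<open>H\<close>.\<close>
  define r where "r h y = H (t + y) * (k (y - h) - k y + h \<bullet> g y)" for h y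
  have [measurable]: "r h \<in> borel_measurable borel" for h
    unfolding r_def by measurable
  \<comment> \<open>Radius \<open>R + 1\<close>: the kernel shifted by a vector of norm below 1
    vanishes outside that ball. The factor 2 counts the increment of \<open>k\<close> and its linear
    part.\<close>
  have r_bound: "\<bar>r h y\<bar> \<le> 2 * B * C * norm h * indicator (cball 0 (R + 1)) y" if "norm h < 1" for h y
  proof (cases "norm y \<le> R + 1")
    case True
    have "\<bar>k (y - h) - k y\<bar> \<le> C * norm h" using k_lip[of "y - h" y] by simp
    moreover have "\<bar>h \<bullet> g y\<bar> \<le> C * norm h"
      using Cauchy_Schwarz_ineq2[of h "g y"] mult_left_mono[OF g_bound[of y], of "norm h"]
      by (simp add: mult.commute)
    ultimately have "\<bar>k (y - h) - k y + h \<bullet> g y\<bar> \<le> 2 * C * norm h" by linarith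
    then have "\<bar>r h y\<bar> \<le> B * (2 * C * norm h)"
      unfolding r_def abs_mult using B True by (intro mult_mono) auto
    then show ?thesis using True by (simp add: mult.assoc mult.left_commute)
  next
    case False
    then have "norm (y - h) > R" using that norm_triangle_ineq2[of y h] by linarith
    then show ?thesis using False by (simp add: r_def k_supp g_supp)
  qed
  have int_k: "integrable lborel (\<lambda>y. k (y - h) * H (t + y))" if "norm h < 1" for h
  proof -
    obtain D where D: "D > 0" "\<And>y. norm y \<le> R + 1 \<Longrightarrow> \<bar>k (- h + y)\<bar> \<le> D"
      using continuous_bounded_on_cball[OF k_cont] by metis
    show ?thesis
    proof (rule integrable_lborel_bounded_support)
    show "norm (k (y - h) * H (t + y)) \<le> D * B" if "norm y \<le> R + 1" for y
      unfolding real_norm_def abs_mult using D(1) D(2)[OF that] B(1) B(2)[OF that]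
      by (intro mult_mono) auto
    show "k (y - h) * H (t + y) = 0" if "norm y > R + 1" for y
      using that \<open>norm h < 1\<close> norm_triangle_ineq2[of y h] by (simp add: k_supp)
    qed simp
  qed
  have int_g: "integrable lborel (\<lambda>y. H (t + y) *\<^sub>R g y)"
  proof (rule integrable_lborel_bounded_support)
    show "norm (H (t + y) *\<^sub>R g y) \<le> B * C" if "norm y \<le> R" for y
      unfolding norm_scaleR using B that g_bound by (intro mult_mono) auto
  qed (auto simp: g_supp)
  let ?V = "\<lambda>t. \<integral>y. k y * H (t + y) \<partial>lborel"
  let ?D = "- (\<integral>y. H (t + y) *\<^sub>R g y \<partial>lborel)"
  have remainder: "?V (t + h) - ?V t - h \<bullet> ?D = (\<integral>y. r h y \<partial>lborel)" if h: "norm h < 1" for h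
  proof -
    have "?V (t + h) = (\<integral>y. k (y - h) * H (t + y) \<partial>lborel)"
      using lborel_integral_shift[of "\<lambda>y. k (y - h) * H (t + y)" h] by (simp add: add.assoc)
    moreover have "h \<bullet> ?D = - (\<integral>y. h \<bullet> (H (t + y) *\<^sub>R g y) \<partial>lborel)"
      using int_g by (simp del: inner_scaleR_right)
    ultimately have "?V (t + h) - ?V t - h \<bullet> ?D =
        (\<integral>y. k (y - h) * H (t + y) - k y * H (t + y) + h \<bullet> (H (t + y) *\<^sub>R g y) \<partial>lborel)"
      using int_k[OF h] int_k[of 0] int_g by (simp del: inner_scaleR_right)
    also have "\<dots> = (\<integral>y. r h y \<partial>lborel)"
      by (intro Bochner_Integration.integral_cong) (auto simp: r_def algebra_simps)
    finally show ?thesis .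
  qed
  \<comment> \<open>The limit is taken within the unit ball, where the remainder formula and its
    bound hold; the ball is open, so the restriction is dropped at the end. Sequences appear because
    dominated convergence is applied along them.\<close>
  have lim: "((\<lambda>h. (\<integral>y. r h y \<partial>lborel) / norm h) \<longlongrightarrow> 0) (at 0 within ball 0 1)"
    unfolding tendsto_at_iff_sequentially
  proof (intro allI impI)
    fix s :: "nat \<Rightarrow> 'a" assume s: "\<forall>i. s i \<in> ball 0 1 - {0}" and s0: "s \<longlonglongrightarrow> 0"
    have "(\<lambda>i. \<integral>y. r (s i) y / norm (s i) \<partial>lborel) \<longlonglongrightarrow> (\<integral>y. (0::real) \<partial>(lborel :: 'a measure))"
    proof (rule integral_dominated_convergence[where w = "\<lambda>y. 2 * B * C * indicator (cball 0 (R + 1)) y"])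
      show "integrable lborel (\<lambda>y::'a. 2 * B * C * indicator (cball 0 (R + 1)) y)"
        using emeasure_lborel_cball_finite[of "0::'a" "R + 1"] by (auto simp: less_top)
      show "AE y in lborel. (\<lambda>i. r (s i) y / norm (s i)) \<longlonglongrightarrow> 0"
        using deriv
      proof eventually_elim
        case (elim y)
        then have "((\<lambda>h. norm (k (y + h) - k y - h \<bullet> g y) / norm h) \<longlongrightarrow> 0) (at 0)"
          unfolding gderiv_def has_derivative_at by simp
        moreover have "filterlim (\<lambda>i. - s i) (at 0) sequentially"
          unfolding filterlim_at using s s0 by (auto simp: tendsto_minus_cancel_left[symmetric])
        ultimately have "(\<lambda>i. norm (k (y + - s i) - k y - (- s i) \<bullet> g y) / norm (- s i)) \<longlonglongrightarrow> 0"
          by (rule filterlim_compose)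
          then have "(\<lambda>i. \<bar>k (y - s i) - k y + s i \<bullet> g y\<bar> / norm (s i)) \<longlonglongrightarrow> 0"
            by simp
          from tendsto_mult_right_zero[OF this, of "\<bar>H (t + y)\<bar>"]
          show ?case
          by (subst tendsto_norm_zero_iff[symmetric]) (simp add: r_def abs_mult)
      qed
      show "AE y in lborel. norm (r (s i) y / norm (s i)) \<le> 2 * B * C * indicator (cball 0 (R + 1)) y" for i
      proof (rule AE_I2)
        fix y
        have "norm (s i) < 1" "s i \<noteq> 0" using s by auto
        then show "norm (r (s i) y / norm (s i)) \<le> 2 * B * C * indicator (cball 0 (R + 1)) y"
          using r_bound[of "s i" y] by (simp add: pos_divide_le_eq mult_ac)
      qed
    qed simp_all
    then show "((\<lambda>h. (\<integral>y. r h y \<partial>lborel) / norm h) \<circ> s) \<longlonglongrightarrow> 0"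
      by (simp add: comp_def)
  qed
  have "((\<lambda>h. norm (?V (t + h) - ?V t - h \<bullet> ?D) / norm h) \<longlongrightarrow> 0) (at 0 within ball 0 1)"
  proof (rule Lim_transform_eventually[OF tendsto_norm_zero[OF lim]])
    show "\<forall>\<^sub>F h in at 0 within ball 0 1. norm ((\<integral>y. r h y \<partial>lborel) / norm h) = norm (?V (t + h) - ?V t - h \<bullet> ?D) / norm h"
      by (auto simp: eventually_at_filter remainder simp del: inner_minus_right)
  qed 
  then have "((\<lambda>h. norm (?V (t + h) - ?V t - h \<bullet> ?D) / norm h) \<longlongrightarrow> 0) (at 0)"
    by (simp only: at_within_open[OF centre_in_ball[THEN iffD2, OF zero_less_one] open_ball])
  then show ?thesis
    unfolding gderiv_def has_derivative_at by (simp only: bounded_linear_inner_left)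
qed


section \<open>Radial integrals over balls and the cone cutoff\<close>

lemma cball_borel [measurable]: "cball (a::'a::metric_space) r \<in> sets borel"
  by (intro borel_closed closed_cball)

text \<open>Dilation by \<open>c\<close> leaves \<open>sgn\<close> unchanged, so only the Jacobian
  factor survives. This homogeneity stands in for polar coordinates.\<close>

lemma integral_cball_sgn:
  fixes h :: "'a::euclidean_space \<Rightarrow> 'b::{banach,second_countable_topology}"
  assumes [measurable]: "h \<in> borel_measurable borel" and c: "c > 0"
  shows "(\<integral>y. indicator (cball 0 c) y *\<^sub>R h (sgn y) \<partial>lborel) =
    c ^ DIM('a) *\<^sub>R (\<integral>y. indicator (cball 0 1) y *\<^sub>R h (sgn y) \<partial>lborel)"
proof -
  have m: "(\<lambda>y. indicat_real (cball 0 c) y *\<^sub>R h (sgn y)) \<in> borel_measurable borel"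
    by measurable
  have "(\<integral>y. indicator (cball 0 c) y *\<^sub>R h (sgn y) \<partial>lborel) =
      (\<integral>y. indicator (cball 0 c) y *\<^sub>R h (sgn y)
        \<partial>density (distr lborel borel (\<lambda>x. 0 + c *\<^sub>R x)) (\<lambda>_. \<bar>c\<bar> ^ DIM('a)))"
    using lborel_affine[of c "0::'a"] c by simp
  also have "\<dots> = (\<integral>y. (c ^ DIM('a)) *\<^sub>R (indicator (cball 0 c) (c *\<^sub>R y) *\<^sub>R h (sgn (c *\<^sub>R y))) \<partial>lborel)"
    using c m by (subst integral_density) (auto intro!: integral_distr simp flip: scaleR_scaleR)
  also have "\<dots> = (\<integral>y. (c ^ DIM('a)) *\<^sub>R (indicator (cball 0 1) y *\<^sub>R h (sgn y)) \<partial>lborel)"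
    using c by (intro Bochner_Integration.integral_cong) (auto simp: indicator_def sgn_scaleR)
  also have "\<dots> = c ^ DIM('a) *\<^sub>R (\<integral>y. indicator (cball 0 1) y *\<^sub>R h (sgn y) \<partial>lborel)"
    by (rule integral_scaleR_right)
  finally show ?thesis .
qed

lemma integrable_cball_sgn:
  fixes h :: "'a::euclidean_space \<Rightarrow> 'b::{banach,second_countable_topology}"
  assumes [measurable]: "h \<in> borel_measurable borel" and "\<And>y. norm y \<le> 1 \<Longrightarrow> norm (h y) \<le> B"
  shows "integrable lborel (\<lambda>y. indicator (cball 0 c) y *\<^sub>R h (sgn y))"
proof (rule integrable_lborel_bounded_support[where R = c and B = B])
  show "(\<lambda>y. indicat_real (cball 0 c) y *\<^sub>R h (sgn y)) \<in> borel_measurable borel"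
    by measurable
qed (use assms(2) in \<open>auto simp: norm_sgn\<close>)

text \<open>As \<open>d\<close> tends to 0, the cutoff tends to the indicator of the unit ball, while its gradient
  concentrates on the unit sphere. This replaces a divergence theorem on the ball.\<close>

definition cone_cutoff :: "real \<Rightarrow> 'a::real_normed_vector \<Rightarrow> real" where
  "cone_cutoff d y = min 1 (max 0 ((1 - norm y) / d))"

lemma AE_norm_neq: "AE y in lborel. norm (y::'a::euclidean_space) \<noteq> c"
proof -
  have "sphere (0::'a) c \<in> null_sets lborel"
    using negligible_sphere[of "0::'a" c]
    by (auto simp: null_sets_completion_iff negligible_iff_null_sets)
  then show ?thesis by (intro AE_I'[of "sphere 0 c"]) auto
qed

text \<open>Away from the two spheres where it has kinks, the cutoff is locally constant or affine
  in the norm with slope \<open>- 1 / d\<close>. The difference of the indicators selects the shell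
  between these spheres.\<close>

lemma GDERIV_cone_cutoff:
  fixes y :: "'a::euclidean_space"
  assumes d: "0 < d" "d < 1" and y: "norm y \<noteq> 1" "norm y \<noteq> 1 - d"
  shows "GDERIV (cone_cutoff d) y :> (- (indicator (cball 0 1) y - indicator (cball 0 (1 - d)) y) / d) *\<^sub>R sgn y"
proof -
  have const: "GDERIV (cone_cutoff d) y :> 0"
    if "open S" "y \<in> S" "\<And>z. z \<in> S \<Longrightarrow> cone_cutoff d z = c" for S c
    unfolding gderiv_def inner_zero_right
    by (rule has_derivative_transform_within_open[OF has_derivative_const[of c] that(1,2)])
       (use that(3) in auto)
  consider "norm y < 1 - d" | "1 - d < norm y" "norm y < 1" | "1 < norm y"
    using y by linarith
  then show ?thesis
  proof cases
    case 1
    then show ?thesis using const[of "ball 0 (1 - d)" 1] d by (auto simp: cone_cutoff_def field_simps)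
  next
    case 3
    have "cone_cutoff d z = 0" if "z \<in> - cball 0 1" for z :: 'a
      using that d by (auto simp: cone_cutoff_def divide_nonpos_pos)
    then show ?thesis using const[of "- cball 0 1" 0] 3 d by auto
  next
    case 2
    then have "y \<noteq> 0" using d by auto
    have "GDERIV (\<lambda>z. (1 / d) *\<^sub>R (1 - norm z)) y :> (- 1 / d) *\<^sub>R sgn y"
      using GDERIV_norm[OF \<open>y \<noteq> 0\<close>] d unfolding gderiv_def
      by (auto intro!: derivative_eq_intros)
    then have "GDERIV (cone_cutoff d) y :> (- 1 / d) *\<^sub>R sgn y"
      unfolding gderiv_def
      by (rule has_derivative_transform_within_open[where s = "ball 0 1 - cball 0 (1 - d)"])
         (use 2 d in \<open>auto simp: cone_cutoff_def field_simps\<close>)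
    then show ?thesis using 2 d by simp
  qed
qed

lemma cone_cutoff_lipschitz:
  assumes "d > 0"
  shows "\<bar>cone_cutoff d x - cone_cutoff d y\<bar> \<le> 1 / d * norm (x - y)"
proof -
  have "\<bar>cone_cutoff d x - cone_cutoff d y\<bar> \<le> \<bar>(1 - norm x) / d - (1 - norm y) / d\<bar>"
    unfolding cone_cutoff_def by linarith
  also have "\<dots> = \<bar>norm y - norm x\<bar> / d"
    using assms by (simp add: diff_divide_distrib[symmetric] abs_divide)
  also have "\<dots> \<le> norm (x - y) / d"
    using norm_triangle_ineq3[of y x] assms by (simp add: divide_right_mono norm_minus_commute)
  finally show ?thesis by simp
qed


section \<open>The gradient of an integral over a translated ball\<close>

text \<open>The quotient is the relative volume of a shell of thickness \<open>d\<close> inside the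
  unit ball, divided by \<open>d\<close>. Its limit is the origin of the dimension factor in the
  gradient estimator.\<close>

lemma tendsto_one_minus_power_quotient:
  "((\<lambda>d::real. (1 - (1 - d) ^ n) / d) \<longlongrightarrow> real n) (at 0)"
proof -
  have "((\<lambda>x::real. - ((1 - x) ^ n)) has_real_derivative real n) (at 0)"
    by (auto intro!: derivative_eq_intros)
  then show ?thesis by (simp add: DERIV_def)
qed

text \<open>In polar coordinates the dimension times the ball integral of a function of
  \<open>sgn y\<close> is its integral over the unit sphere, so the formula is the divergence
  theorem for the ball. The cutoff integrals \<open>J d\<close> converge to the ball integral and
  their gradients \<open>DJ d\<close> converge uniformly near \<open>t0\<close>, which allows the
  limit to be differentiated.\<close>

theorem GDERIV_cball_integral:
  fixes H :: "'a::euclidean_space \<Rightarrow> real"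
  assumes lip: "\<And>x y. \<bar>H x - H y\<bar> \<le> L * norm (x - y)"
  shows "GDERIV (\<lambda>t. \<integral>y. indicator (cball 0 1) y * H (t + y) \<partial>lborel) t0 :>
    real DIM('a) *\<^sub>R (\<integral>y. indicator (cball 0 1) y *\<^sub>R (H (t0 + sgn y) *\<^sub>R sgn y) \<partial>lborel)"
proof -
  obtain b :: 'a where "b \<in> Basis" using nonempty_Basis by blast
  then have L: "L \<ge> 0" using lip[of b 0] by (auto simp: order_trans[OF abs_ge_zero])
  have H: "continuous_on UNIV H"
    by (rule lipschitz_on_continuous_on[where L = L]) (auto intro!: lipschitz_onI simp: dist_norm lip L)
  then have [measurable]: "H \<in> borel_measurable borel" by (rule borel_measurable_continuous_onI)
  \<comment> \<open>For \<open>t\<close> in the unit ball around \<open>t0\<close> and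
    \<open>norm y \<le> 1\<close>, the point \<open>t + y\<close> is within 2 of
    \<open>t0\<close>.\<close>
  define B where "B = \<bar>H t0\<bar> + 2 * L"
  have B: "\<bar>H (t + y)\<bar> \<le> B" if "t \<in> ball t0 1" "norm y \<le> 1" for t y
  proof -
    have "norm (t + y - t0) \<le> 2"
      using norm_triangle_ineq[of "t - t0" y] that by (simp add: dist_norm norm_minus_commute algebra_simps)
    then have "L * norm (t + y - t0) \<le> L * 2" using L by (rule mult_left_mono)
    then show ?thesis using lip[of "t + y" t0] unfolding B_def by linarith
  qed
  have B0: "B \<ge> 0" unfolding B_def using L by simp
  define vol where "vol = (\<integral>y. indicator (cball 0 1) (y::'a) *\<^sub>R (1::real) \<partial>lborel)"
  define n where "n = DIM('a)"
  define I where "I t = (\<integral>y. indicator (cball 0 1) y *\<^sub>R (H (t + sgn y) *\<^sub>R sgn y) \<partial>lborel)" for t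
  define s :: "real \<Rightarrow> 'a \<Rightarrow> real" where "s d y = indicator (cball 0 1) y - indicator (cball 0 (1 - d)) y" for d y
  have [measurable]: "s d \<in> borel_measurable borel" for d unfolding s_def by measurable
  have [measurable]: "(cone_cutoff d :: 'a \<Rightarrow> real) \<in> borel_measurable borel" for d
    unfolding cone_cutoff_def by measurable
  have s01: "0 \<le> s d y" "s d y \<le> 1" if "0 < d" for d y
    using that by (auto simp: s_def indicator_def)
  have s_supp: "s d y = 0" if "0 < d" "norm y > 1" for d y
    using that by (auto simp: s_def indicator_def)
  \<comment> \<open>Outer ball minus inner ball: by homogeneity a function of the direction
    integrates over the shell to the fraction \<open>1 - (1 - d) ^ n\<close> of its integral over
    the ball.\<close>
  have int_shell: "(\<integral>y. s d y *\<^sub>R h (sgn y) \<partial>lborel) =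
      (1 - (1 - d) ^ n) *\<^sub>R (\<integral>y. indicator (cball 0 1) y *\<^sub>R h (sgn y) \<partial>lborel)"
    if [measurable]: "h \<in> borel_measurable borel" and "\<And>y. norm y \<le> 1 \<Longrightarrow> norm (h y) \<le> D" and d: "0 < d" "d < 1"
    for h :: "'a \<Rightarrow> 'b::{banach,second_countable_topology}" and d D
  proof -
    note int = integrable_cball_sgn[of h D, OF that(1,2)]
    have "(\<integral>y. s d y *\<^sub>R h (sgn y) \<partial>lborel) =
        (\<integral>y. indicator (cball 0 1) y *\<^sub>R h (sgn y) \<partial>lborel) - (\<integral>y. indicator (cball 0 (1 - d)) y *\<^sub>R h (sgn y) \<partial>lborel)"
      using int unfolding s_def by (simp add: scaleR_diff_left)
    then show ?thesis
      using integral_cball_sgn[OF that(1), of "1 - d"] d by (simp add: n_def algebra_simps)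
  qed
  have int_s: "(\<integral>y. s d y \<partial>lborel) = (1 - (1 - d) ^ n) * vol" if "0 < d" "d < 1" for d
    using int_shell[of "\<lambda>_. 1::real" 1 d] that unfolding vol_def by simp
  have integrable_s: "integrable lborel (\<lambda>y. s d y *\<^sub>R F y)"
    if [measurable]: "F \<in> borel_measurable borel" and "\<And>y. norm y \<le> 1 \<Longrightarrow> norm (F y) \<le> D" "0 < d" "d < 1"
    for F :: "'a \<Rightarrow> 'b::{banach,second_countable_topology}" and D d
  proof (rule integrable_lborel_bounded_support[where R = 1 and B = D])
    show "norm (s d y *\<^sub>R F y) \<le> D" if "norm y \<le> 1" for y
      using mult_mono[of "\<bar>s d y\<bar>" 1 "norm (F y)" D] s01[of d y] \<open>\<And>y. norm y \<le> 1 \<Longrightarrow> norm (F y) \<le> D\<close>[OF that] \<open>0 < d\<close> by simp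
  qed (use s_supp that in auto)
  define J where "J d t = (\<integral>y. cone_cutoff d y * H (t + y) \<partial>lborel)" for d t
  define DJ where "DJ d t = (1 / d) *\<^sub>R (\<integral>y. s d y *\<^sub>R (H (t + y) *\<^sub>R sgn y) \<partial>lborel)" for d t
  have deriv_J: "GDERIV (J d) t :> DJ d t" if d: "0 < d" "d < 1" for d t
  proof -
    have "GDERIV (\<lambda>t. \<integral>y. cone_cutoff d y * H (t + y) \<partial>lborel) t :>
        - (\<integral>y. H (t + y) *\<^sub>R ((- s d y / d) *\<^sub>R sgn y) \<partial>lborel)"
    proof (rule GDERIV_convolution[where R = 1 and C = "1 / d"])
      show "AE y in lborel. GDERIV (cone_cutoff d) y :> (- s d y / d) *\<^sub>R sgn y"
        using AE_norm_neq[of 1] AE_norm_neq[of "1 - d"]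
        by eventually_elim (unfold s_def, intro GDERIV_cone_cutoff d)
      show "norm ((- s d y / d) *\<^sub>R sgn y) \<le> 1 / d" for y
        using s01[of d y] d by (auto simp: norm_sgn divide_right_mono)
    qed (use H cone_cutoff_lipschitz d s_supp in \<open>auto simp: cone_cutoff_def divide_nonpos_pos\<close>)
    also have "(\<lambda>y. H (t + y) *\<^sub>R ((- s d y / d) *\<^sub>R sgn y)) = (\<lambda>y. (- 1 / d) *\<^sub>R (s d y *\<^sub>R (H (t + y) *\<^sub>R sgn y)))"
      by auto
    also have "- (\<integral>y. (- 1 / d) *\<^sub>R (s d y *\<^sub>R (H (t + y) *\<^sub>R sgn y)) \<partial>lborel) = DJ d t"
      unfolding DJ_def by (subst integral_scaleR_right) simp
    finally show ?thesis unfolding J_def[abs_def] .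
  qed
  \<comment> \<open>The first summand pays for replacing \<open>y\<close> by \<open>sgn y\<close> in
    the shell: the distance is at most \<open>d\<close>, which cancels the slope
    \<open>1 / d\<close>. The second pays for replacing the volume quotient by \<open>n\<close>.
    Neither depends on \<open>t\<close>, so the gradients converge uniformly.\<close>
  define c where "c d = L * ((1 - (1 - d) ^ n) * vol) + \<bar>(1 - (1 - d) ^ n) / d - real n\<bar> * (B * vol)" for d
  have norm_I: "norm (I t) \<le> B * vol" if "t \<in> ball t0 1" for t
  proof -
    have bd: "norm (H (t + y) *\<^sub>R y) \<le> B" if "norm y \<le> 1" for y
      using mult_mono[OF B[OF \<open>t \<in> ball t0 1\<close> that] that B0] by simp
    have "norm (I t) \<le> (\<integral>y. indicat_real (cball 0 1) (y::'a) *\<^sub>R B \<partial>lborel)"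
      unfolding I_def
    proof (rule Bochner_Integration.integral_norm_bound_integral)
      show "integrable lborel (\<lambda>y. indicat_real (cball 0 1) y *\<^sub>R H (t + sgn y) *\<^sub>R sgn y)"
        using integrable_cball_sgn[of "\<lambda>y. H (t + y) *\<^sub>R y" B 1] bd by simp
      show "integrable lborel (\<lambda>y::'a. indicat_real (cball 0 1) y *\<^sub>R B)"
        using integrable_cball_sgn[of "\<lambda>y::'a. B" B 1] B0 by simp
      show "norm (indicat_real (cball 0 1) y *\<^sub>R H (t + sgn y) *\<^sub>R sgn y) \<le> indicat_real (cball 0 1) y *\<^sub>R B" for y
        using bd[of "sgn y"] by (auto simp: indicator_def norm_sgn)
    qed
    also have "\<dots> = B * vol" unfolding vol_def by simp
    finally show ?thesis .
  qed
  have DJ_close: "norm (DJ d t - real n *\<^sub>R I t) \<le> c d" if t: "t \<in> ball t0 1" and d: "0 < d" "d < 1" for d t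
  proof -
    have bd: "norm (H (t + y) *\<^sub>R y) \<le> B" if "norm y \<le> 1" for y
      using mult_mono[OF B[OF t that] that B0] by simp
    have bd2: "norm (H (t + y) *\<^sub>R sgn y) \<le> B" if "norm y \<le> 1" for y
      using mult_mono[OF B[OF t that] _ B0, of "norm (sgn y)" 1] by (auto simp: norm_sgn)
    have bd3: "norm (H (t + sgn y) *\<^sub>R sgn y) \<le> B" for y
      using bd[of "sgn y"] by (auto simp: norm_sgn)
    define E where "E = (\<integral>y. s d y *\<^sub>R (H (t + y) *\<^sub>R sgn y - H (t + sgn y) *\<^sub>R sgn y) \<partial>lborel)"
    have "DJ d t = (1 / d) *\<^sub>R (E + (\<integral>y. s d y *\<^sub>R (H (t + sgn y) *\<^sub>R sgn y) \<partial>lborel))"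
      unfolding DJ_def E_def using integrable_s[OF _ bd2 d] integrable_s[OF _ bd3 d]
      by (simp add: scaleR_diff_right)
    also have "(\<integral>y. s d y *\<^sub>R (H (t + sgn y) *\<^sub>R sgn y) \<partial>lborel) = (1 - (1 - d) ^ n) *\<^sub>R I t"
      unfolding I_def by (rule int_shell[OF _ bd d]) simp
    finally have "DJ d t - real n *\<^sub>R I t = (1 / d) *\<^sub>R E + ((1 - (1 - d) ^ n) / d - real n) *\<^sub>R I t"
      by (simp add: scaleR_add_right scaleR_diff_left scaleR_diff_right diff_divide_distrib)
    then have "norm (DJ d t - real n *\<^sub>R I t) \<le> norm ((1 / d) *\<^sub>R E) + norm (((1 - (1 - d) ^ n) / d - real n) *\<^sub>R I t)"
      by (simp only: norm_triangle_ineq)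
    also have "norm (((1 - (1 - d) ^ n) / d - real n) *\<^sub>R I t) \<le> \<bar>(1 - (1 - d) ^ n) / d - real n\<bar> * (B * vol)"
      unfolding norm_scaleR by (intro mult_left_mono norm_I t) simp
    also have "norm ((1 / d) *\<^sub>R E) \<le> L * ((1 - (1 - d) ^ n) * vol)"
    proof -
      have "norm E \<le> (\<integral>y. s d y *\<^sub>R (L * d) \<partial>lborel)"
        unfolding E_def
      proof (rule Bochner_Integration.integral_norm_bound_integral)
        show "integrable lborel (\<lambda>y. s d y *\<^sub>R (H (t + y) *\<^sub>R sgn y - H (t + sgn y) *\<^sub>R sgn y))"
          using integrable_s[OF _ bd2 d] integrable_s[OF _ bd3 d] by (simp add: scaleR_diff_right)
        show "integrable lborel (\<lambda>y. s d y *\<^sub>R (L * d))"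
          using integrable_s[of "\<lambda>_. L * d" "L * d" d] L d by simp
        show "norm (s d y *\<^sub>R (H (t + y) *\<^sub>R sgn y - H (t + sgn y) *\<^sub>R sgn y)) \<le> s d y *\<^sub>R (L * d)" for y
        proof (cases "1 - d < norm y \<and> norm y \<le> 1")
          case True
          then have y0: "y \<noteq> 0" using d by auto
          have "norm (y - sgn y) = \<bar>norm y - 1\<bar>"
          proof -
            have "y - sgn y = (norm y - 1) *\<^sub>R sgn y" using y0 by (simp add: sgn_div_norm left_diff_distrib scaleR_diff_left)
            then show ?thesis using y0 by (simp add: norm_sgn)
          qed
          also have "\<dots> \<le> d" using True by auto
          finally have "\<bar>H (t + y) - H (t + sgn y)\<bar> \<le> L * d"
            using lip[of "t + y" "t + sgn y"] mult_left_mono[OF _ L] by (smt (verit) add_diff_cancel_left)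
          then show ?thesis using y0 s01[of d y] d
            by (simp add: scaleR_diff_left[symmetric] norm_sgn abs_mult mult_left_mono)
        next
          case False
          then have "s d y = 0" using d by (auto simp: s_def indicator_def)
          then show ?thesis by simp
        qed
      qed
      also have "\<dots> = L * d * ((1 - (1 - d) ^ n) * vol)"
        using int_s[OF d] by simp
      finally show ?thesis using d by (simp add: field_simps)
    qed
    finally show ?thesis unfolding c_def by simp
  qed
  define V where "V t = (\<integral>y. indicator (cball 0 1) y * H (t + y) \<partial>lborel)" for t
  have J_close: "\<bar>J d t - V t\<bar> \<le> B * ((1 - (1 - d) ^ n) * vol)" if t: "t \<in> ball t0 1" and d: "0 < d" "d < 1" for d t
  proof -
    have k01: "0 \<le> cone_cutoff d y" "cone_cutoff d y \<le> 1" "norm y > 1 \<Longrightarrow> cone_cutoff d y = 0" for y :: 'a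
      using d by (auto simp: cone_cutoff_def divide_nonpos_pos)
    \<comment> \<open>Off the shell the cutoff agrees with the indicator of the unit ball; inside it
      they differ by at most 1.\<close>
    have ks: "\<bar>cone_cutoff d y - indicator (cball 0 1) y\<bar> \<le> s d y" for y :: 'a
      using d by (auto simp: cone_cutoff_def s_def indicator_def min_def max_def field_simps)
    have i1: "integrable lborel (\<lambda>y. cone_cutoff d y * H (t + y))"
    proof (rule integrable_lborel_bounded_support[where R = 1 and B = B])
      show "norm (cone_cutoff d y * H (t + y)) \<le> B" if "norm y \<le> 1" for y
        using mult_mono[OF k01(2)[of y] B[OF t that]] k01(1)[of y] by (simp add: abs_mult)
    qed (use k01 in auto)
    have i2: "integrable lborel (\<lambda>y. indicator (cball 0 1) y * H (t + y))"
    proof (rule integrable_lborel_bounded_support[where R = 1 and B = B])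
      show "norm (indicat_real (cball 0 1) y * H (t + y)) \<le> B" if "norm y \<le> 1" for y
        using B[OF t that] that by simp
    qed auto
    have "\<bar>J d t - V t\<bar> = norm (\<integral>y. cone_cutoff d y * H (t + y) - indicator (cball 0 1) y * H (t + y) \<partial>lborel)"
      unfolding J_def V_def using i1 i2 by simp
    also have "\<dots> \<le> (\<integral>y. s d y *\<^sub>R B \<partial>lborel)"
    proof (rule Bochner_Integration.integral_norm_bound_integral)
      show "integrable lborel (\<lambda>y. s d y *\<^sub>R B)"
        using integrable_s[of "\<lambda>_. B" B d] B0 d by simp
      show "norm (cone_cutoff d y * H (t + y) - indicator (cball 0 1) y * H (t + y)) \<le> s d y *\<^sub>R B" for y
      proof (cases "norm y \<le> 1")
        case True
        then show ?thesis
          unfolding left_diff_distrib[symmetric] real_norm_def abs_mult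
          using mult_mono[OF ks[of y] B[OF t True]] s01[of d y] d by simp
      next
        case False
        then show ?thesis using k01(3)[of y] s_supp[of d y] d by simp
      qed
    qed (use i1 i2 in auto)
    also have "\<dots> = B * ((1 - (1 - d) ^ n) * vol)"
      using int_s[OF d] by simp
    finally show ?thesis .
  qed
  \<comment> \<open>The summand 2 keeps the thickness strictly below 1 already at
    \<open>m = 0\<close>.\<close>
  define \<delta> where "\<delta> m = 1 / real (m + 2)" for m :: nat
  have \<delta>: "0 < \<delta> m" "\<delta> m < 1" for m by (auto simp: \<delta>_def)
  have \<delta>0: "\<delta> \<longlonglongrightarrow> 0"
    unfolding \<delta>_def[abs_def] by (intro LIMSEQ_ignore_initial_segment[OF lim_1_over_n])
  have quot: "(\<lambda>m. (1 - (1 - \<delta> m) ^ n) / \<delta> m) \<longlonglongrightarrow> real n"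
    by (rule filterlim_compose[OF tendsto_one_minus_power_quotient])
       (use \<delta>0 \<delta> in \<open>auto simp: filterlim_at less_imp_neq[THEN not_sym]\<close>)
  have pow0: "(\<lambda>m. 1 - (1 - \<delta> m) ^ n) \<longlonglongrightarrow> 0"
    using tendsto_diff[OF tendsto_const[of 1] tendsto_power[OF tendsto_diff[OF tendsto_const[of 1] \<delta>0], of n]] by simp
  have c0: "(\<lambda>m. c (\<delta> m)) \<longlonglongrightarrow> 0"
    unfolding c_def
    by (intro tendsto_add_zero[OF tendsto_mult_right_zero[OF tendsto_mult_left_zero[OF pow0]]]
        tendsto_mult_left_zero[OF tendsto_rabs_zero[OF LIM_zero[OF quot]]])
  have J_lim: "(\<lambda>m. J (\<delta> m) t) \<longlonglongrightarrow> V t" if t: "t \<in> ball t0 1" for t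
  proof (rule LIM_zero_cancel, rule Lim_null_comparison)
    show "(\<lambda>m. B * ((1 - (1 - \<delta> m) ^ n) * vol)) \<longlonglongrightarrow> 0"
      by (rule tendsto_mult_right_zero[OF tendsto_mult_left_zero[OF pow0]])
  qed (use J_close[OF t \<delta>] in auto)
  \<comment> \<open>Uniform convergence of the derivatives yields some differentiable limit
    \<open>g\<close>; uniqueness of pointwise limits then identifies it with \<open>V\<close> on the
    ball.\<close>
  have "\<exists>g. \<forall>x\<in>ball t0 1. (\<lambda>m. J (\<delta> m) x) \<longlonglongrightarrow> g x \<and>
      (g has_derivative (\<lambda>h. h \<bullet> (real n *\<^sub>R I x))) (at x within ball t0 1)"
  proof (rule has_derivative_sequence)
    show "(J (\<delta> m) has_derivative (\<lambda>h. h \<bullet> DJ (\<delta> m) x)) (at x within ball t0 1)" for m x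
      using deriv_J[OF \<delta>] unfolding gderiv_def by (rule has_derivative_at_withinI)
    show "\<forall>\<^sub>F m in sequentially. \<forall>x\<in>ball t0 1. \<forall>h. norm (h \<bullet> DJ (\<delta> m) x - h \<bullet> real n *\<^sub>R I x) \<le> e * norm h"
      if "e > 0" for e
      using order_tendstoD(2)[OF c0 \<open>e > 0\<close>]
    proof eventually_elim
      case (elim m)
      show ?case
      proof (intro ballI allI)
        fix x h assume "x \<in> ball t0 1"
        have "norm (h \<bullet> DJ (\<delta> m) x - h \<bullet> real n *\<^sub>R I x) \<le> norm h * norm (DJ (\<delta> m) x - real n *\<^sub>R I x)"
          unfolding inner_diff_right[symmetric] real_norm_def by (rule Cauchy_Schwarz_ineq2)
        also have "\<dots> \<le> norm h * e"
          using DJ_close[OF \<open>x \<in> ball t0 1\<close> \<delta>, of m] elim by (intro mult_left_mono) auto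
        finally show "norm (h \<bullet> DJ (\<delta> m) x - h \<bullet> real n *\<^sub>R I x) \<le> e * norm h"
          by (simp add: mult.commute)
      qed
    qed
    show "(\<lambda>m. J (\<delta> m) t0) \<longlonglongrightarrow> V t0" by (rule J_lim) simp
  qed auto
  then obtain g where g: "\<And>x. x \<in> ball t0 1 \<Longrightarrow> (\<lambda>m. J (\<delta> m) x) \<longlonglongrightarrow> g x"
      "(g has_derivative (\<lambda>h. h \<bullet> (real n *\<^sub>R I t0))) (at t0 within ball t0 1)"
    by (metis centre_in_ball zero_less_one)
  have "V x = g x" if "x \<in> ball t0 1" for x
    using LIMSEQ_unique[OF J_lim[OF that] g(1)[OF that]] .
  moreover have "(g has_derivative (\<lambda>h. h \<bullet> (real n *\<^sub>R I t0))) (at t0)"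
    using g(2) by (simp add: at_within_open[of t0 "ball t0 1"])
  ultimately have "(V has_derivative (\<lambda>h. h \<bullet> (real n *\<^sub>R I t0))) (at t0)"
    by (metis has_derivative_transform_within_open open_ball centre_in_ball zero_less_one)
  then show ?thesis
    unfolding gderiv_def V_def[abs_def] I_def n_def .
qed


section \<open>Gradients, quadratic upper bounds and the squared distance to a convex set\<close>

lemma GDERIV_unique:
  assumes "GDERIV h x :> D" "GDERIV h x :> D'"
  shows "D = D'"
proof -
  have "(\<lambda>h. h \<bullet> D) = (\<lambda>h. h \<bullet> D')"
    using assms unfolding gderiv_def by (rule has_derivative_unique)
  then have "(D - D') \<bullet> D = (D - D') \<bullet> D'" by metis
  then show ?thesis by (metis inner_diff_right inner_eq_zero_iff right_minus_eq)
qed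

lemma gradient_eqI: "GDERIV h x :> D \<Longrightarrow> gradient h x = D"
  unfolding gradient_def using GDERIV_unique by blast

text \<open>Along the segment, \<open>\<phi>\<close> subtracts the linear and the quadratic term
  from \<open>f\<close>. The Lipschitz bound makes its derivative nonpositive, and
  \<open>\<phi> 1 \<le> \<phi> 0\<close> is the claim, so no gradient has to be integrated.\<close>

lemma lipschitz_gradient_upper_bound:
  assumes deriv: "\<And>x. GDERIV f x :> g x"
    and lip: "\<And>x y. norm (g x - g y) \<le> L * norm (x - y)"
  shows "f y \<le> f x + g x \<bullet> (y - x) + L / 2 * (norm (y - x))\<^sup>2"
proof -
  define d where "d = y - x"
  define \<phi> where "\<phi> s = f (x + s *\<^sub>R d) - s * (g x \<bullet> d) - L / 2 * s\<^sup>2 * (norm d)\<^sup>2" for s :: real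
  have "\<phi> 1 \<le> \<phi> 0"
  proof (rule DERIV_nonpos_imp_nonincreasing[where f = \<phi> and a = 0 and b = 1])
    fix s :: real assume s: "0 \<le> s" "s \<le> 1"
    have "((\<lambda>s. f (x + s *\<^sub>R d)) has_derivative (\<lambda>h. (h *\<^sub>R d) \<bullet> g (x + s *\<^sub>R d))) (at s)"
      by (rule has_derivative_compose[OF _ deriv[unfolded gderiv_def]]) (auto intro!: derivative_eq_intros)
    then have "((\<lambda>s. f (x + s *\<^sub>R d)) has_real_derivative (g (x + s *\<^sub>R d) \<bullet> d)) (at s)"
      unfolding has_field_derivative_def
      by (rule has_derivative_eq_rhs) (auto simp: fun_eq_iff inner_commute)
    then have "(\<phi> has_real_derivative (g (x + s *\<^sub>R d) \<bullet> d - g x \<bullet> d - L * s * (norm d)\<^sup>2)) (at s)"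
      unfolding \<phi>_def by (auto intro!: derivative_eq_intros)
    moreover have "g (x + s *\<^sub>R d) \<bullet> d - g x \<bullet> d \<le> L * s * (norm d)\<^sup>2"
    proof -
      have "g (x + s *\<^sub>R d) \<bullet> d - g x \<bullet> d \<le> norm (g (x + s *\<^sub>R d) - g x) * norm d"
        unfolding inner_diff_left[symmetric] by (rule norm_cauchy_schwarz)
      also have "\<dots> \<le> (L * norm (x + s *\<^sub>R d - x)) * norm d"
        by (intro mult_right_mono lip) simp
      finally show ?thesis using s by (simp add: power2_eq_square)
    qed
    ultimately show "\<exists>y. DERIV \<phi> s :> y \<and> y \<le> 0" by force
  qed simp
  then show ?thesis by (simp add: \<phi>_def d_def)
qed

lemma infdist_closest_point:
  "closed S \<Longrightarrow> S \<noteq> {} \<Longrightarrow> infdist x S = norm (x - closest_point S x)"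
  by (metis dist_norm infdist_eq_setdist setdist_closest_point)

text \<open>The projection of \<open>x\<close> is a competitor for the distance from
  \<open>y\<close>; it remains to expand the square of its distance around \<open>x\<close>.\<close>

lemma infdist_square_upper_bound:
  fixes S :: "'a::euclidean_space set"
  assumes S: "closed S" "S \<noteq> {}"
  shows "(infdist y S)\<^sup>2 \<le> (infdist x S)\<^sup>2 + 2 * ((x - closest_point S x) \<bullet> (y - x)) + (norm (y - x))\<^sup>2"
proof -
  have square_norm: "(norm (a + b))\<^sup>2 = (norm a)\<^sup>2 + 2 * (a \<bullet> b) + (norm b)\<^sup>2" for a b :: 'a
    by (simp add: power2_norm_eq_inner inner_add_left inner_add_right inner_commute)
  have "infdist y S \<le> norm (y - closest_point S x)"
    by (metis S closest_point_in_set dist_norm infdist_le)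
  then have "(infdist y S)\<^sup>2 \<le> (norm ((x - closest_point S x) + (y - x)))\<^sup>2"
    by (simp add: infdist_nonneg power_mono)
  also have "\<dots> = (infdist x S)\<^sup>2 + 2 * ((x - closest_point S x) \<bullet> (y - x)) + (norm (y - x))\<^sup>2"
    unfolding infdist_closest_point[OF S] by (rule square_norm)
  finally show ?thesis .
qed

text \<open>The first-order error lies between plus and minus \<open>(norm (y - x))\<^sup>2\<close>.
  The upper half is the preceding bound. The lower half is the same bound with \<open>x\<close> and
  \<open>y\<close> exchanged, where nonexpansiveness of the projection controls the change of base
  point.\<close>

lemma GDERIV_infdist_square:
  fixes S :: "'a::euclidean_space set"
  assumes S: "closed S" "S \<noteq> {}" "convex S"
  shows "GDERIV (\<lambda>x. (infdist x S)\<^sup>2) x :> 2 *\<^sub>R (x - closest_point S x)"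
proof -
  define err where "err y = (infdist y S)\<^sup>2 - (infdist x S)\<^sup>2 - (y - x) \<bullet> (2 *\<^sub>R (x - closest_point S x))" for y
  have err: "\<bar>err y\<bar> \<le> (norm (y - x))\<^sup>2" for y
  proof -
    have "err y \<le> (norm (y - x))\<^sup>2"
      using infdist_square_upper_bound[OF S(1,2), of y x] by (simp add: err_def inner_commute)
    moreover have "- (norm (y - x))\<^sup>2 \<le> err y"
    proof -
      have "(closest_point S y - closest_point S x) \<bullet> (y - x) \<le> norm (closest_point S y - closest_point S x) * norm (y - x)"
        by (rule norm_cauchy_schwarz)
      also have "\<dots> \<le> norm (y - x) * norm (y - x)"
        using closest_point_lipschitz[OF S(3,1,2), of y x] by (intro mult_right_mono) (auto simp: dist_norm)
      finally have 1: "(closest_point S y - closest_point S x) \<bullet> (y - x) \<le> (y - x) \<bullet> (y - x)"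
        by (simp add: power2_norm_eq_inner[symmetric] power2_eq_square)
      have 2: "(infdist x S)\<^sup>2 \<le> (infdist y S)\<^sup>2 + 2 * ((y - closest_point S y) \<bullet> (x - y)) + (x - y) \<bullet> (x - y)"
        using infdist_square_upper_bound[OF S(1,2), of x y] by (simp add: power2_norm_eq_inner)
      show ?thesis
        using 1 2 unfolding err_def power2_norm_eq_inner
        by (simp add: inner_diff_left inner_diff_right inner_commute)
    qed
    ultimately show ?thesis by linarith
  qed
  have "((\<lambda>y. norm (err y) / norm (y - x)) \<longlongrightarrow> 0) (at x)"
  proof (rule Lim_null_comparison)
    show "\<forall>\<^sub>F y in at x. norm (norm (err y) / norm (y - x)) \<le> norm (y - x)"
      using err by (auto simp: eventually_at_filter power2_eq_square pos_divide_le_eq)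
    show "((\<lambda>y. norm (y - x)) \<longlongrightarrow> 0) (at x)"
      by (intro tendsto_norm_zero LIM_zero tendsto_ident_at)
  qed
  then show ?thesis
    unfolding gderiv_def has_derivative_iff_norm err_def using bounded_linear_inner_left by blast
qed

section \<open>Uniform distributions on the ball and on the sphere\<close>

lemma integral_uniform_measure_cball:
  fixes F :: "'a::euclidean_space \<Rightarrow> 'b::{banach,second_countable_topology}"
  assumes [measurable]: "F \<in> borel_measurable borel"
  shows "(\<integral>\<nu>. F \<nu> \<partial>uniform_measure lborel (cball 0 1)) =
    (1 / measure lborel (cball (0::'a) 1)) *\<^sub>R (\<integral>y. indicator (cball 0 1) y *\<^sub>R F y \<partial>lborel)"
proof -
  let ?c = "measure lborel (cball (0::'a) 1)"
  have c: "?c > 0" by (simp add: content_cball_pos)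
  have "uniform_measure lborel (cball 0 1) = density lborel (\<lambda>x::'a. ennreal (indicator (cball 0 1) x / ?c))"
    unfolding uniform_measure_def using c emeasure_lborel_cball_finite[of "0::'a" 1]
    by (intro density_cong)
       (auto simp: emeasure_eq_ennreal_measure less_top divide_ennreal[symmetric] indicator_def)
  then have "(\<integral>\<nu>. F \<nu> \<partial>uniform_measure lborel (cball 0 1)) =
      (\<integral>y. (indicator (cball 0 1) y / ?c) *\<^sub>R F y \<partial>lborel)"
    by (simp add: integral_density)
  also have "\<dots> = (\<integral>y. (1 / ?c) *\<^sub>R (indicator (cball 0 1) y *\<^sub>R F y) \<partial>lborel)"
    by simp
  also have "\<dots> = (1 / ?c) *\<^sub>R (\<integral>y. indicator (cball 0 1) y *\<^sub>R F y \<partial>lborel)"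
    by (rule integral_scaleR_right)
  finally show ?thesis .
qed

lemma prob_space_uniform_cball: "prob_space (uniform_measure lborel (cball (0::'a::euclidean_space) 1))"
  by (rule prob_space_uniform_measure)
     (use content_cball_pos[of 1 "0::'a"] emeasure_lborel_cball_finite[of "0::'a" 1] in \<open>auto simp: measure_def less_top\<close>)

lemma prob_space_uniform_sphere: "prob_space (uniform_sphere :: (real ^ 'n) measure)"
  unfolding uniform_sphere_def by (rule prob_space.prob_space_distr[OF prob_space_uniform_cball]) simp

lemma space_uniform_sphere [simp]: "space uniform_sphere = UNIV"
  and sets_uniform_sphere [measurable_cong, simp]: "sets uniform_sphere = sets borel"
  by (simp_all add: uniform_sphere_def)

lemma AE_uniform_sphere: "AE u in (uniform_sphere :: (real ^ 'n) measure). norm u = 1"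
proof -
  have "AE y in lborel. norm (y :: real ^ 'n) \<noteq> 0" by (rule AE_norm_neq)
  then have "AE y in uniform_measure lborel (cball (0 :: real ^ 'n) 1). norm (sgn y) = 1"
    by (intro AE_uniform_measureI) (auto simp: norm_sgn)
  then show ?thesis
    unfolding uniform_sphere_def by (subst AE_distr_iff) auto
qed

lemma integral_uniform_sphere:
  fixes F :: "real ^ 'n \<Rightarrow> 'b::{banach,second_countable_topology}"
  assumes [measurable]: "F \<in> borel_measurable borel"
  shows "(\<integral>u. F u \<partial>uniform_sphere) =
    (1 / measure lborel (cball (0 :: real ^ 'n) 1)) *\<^sub>R (\<integral>y. indicator (cball 0 1) y *\<^sub>R F (sgn y) \<partial>lborel)"
  unfolding uniform_sphere_def by (subst integral_distr) (simp_all add: integral_uniform_measure_cball)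

lemma integrable_uniform_sphere:
  fixes F :: "real ^ 'n \<Rightarrow> 'b::{banach,second_countable_topology}"
  assumes "F \<in> borel_measurable borel" "\<And>u. norm u = 1 \<Longrightarrow> norm (F u) \<le> B"
  shows "integrable uniform_sphere F"
proof -
  interpret prob_space "uniform_sphere :: (real ^ 'n) measure" by (rule prob_space_uniform_sphere)
  show ?thesis
  proof (rule integrable_const_bound[of _ B])
    show "AE u in uniform_sphere. norm (F u) \<le> B"
      using AE_uniform_sphere by eventually_elim (rule assms(2))
  qed (use assms(1) in simp)
qed

section \<open>The gradient of a ball average as a mean over directions\<close>

text \<open>The factor is the ratio of surface area to volume of a ball of radius
  \<open>\<xi>\<close>; it turns the surface integral in the gradient of the ball average into a
  mean over directions.\<close>

definition sphere_gradient :: "(real ^ 'n \<Rightarrow> real) \<Rightarrow> real \<Rightarrow> real ^ 'n \<Rightarrow> real ^ 'n" where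
  "sphere_gradient H \<xi> \<theta> = (real CARD('n) / \<xi>) *\<^sub>R (\<integral>u. H (\<theta> + \<xi> *\<^sub>R u) *\<^sub>R u \<partial>uniform_sphere)"

locale lipschitz_objective =
  fixes H :: "real ^ 'n::finite \<Rightarrow> real" and L \<xi> :: real
  assumes L: "L \<ge> 0" and lip: "\<And>x y. \<bar>H x - H y\<bar> \<le> L * norm (x - y)" and xi: "\<xi> > 0"
begin

lemma continuous_H: "continuous_on UNIV H"
  by (rule lipschitz_on_continuous_on[where L = L]) (auto intro!: lipschitz_onI simp: dist_norm lip L)

lemma borel_H [measurable]: "H \<in> borel_measurable borel"
  by (rule borel_measurable_continuous_onI[OF continuous_H])

text \<open>The unit-ball formula is applied to \<open>H (\<xi> *\<^sub>R x)\<close> at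
  \<open>(1 / \<xi>) *\<^sub>R \<theta>\<close>, and the chain rule supplies
  \<open>1 / \<xi>\<close>. After division by the volume, ball integrals of functions of
  \<open>sgn y\<close> are sphere means, the sphere law being the image of the ball law under
  \<open>sgn\<close>.\<close>

lemma GDERIV_ball_average:
  "GDERIV (\<lambda>\<theta>. \<integral>\<nu>. H (\<theta> + \<xi> *\<^sub>R \<nu>) \<partial>uniform_measure lborel (cball 0 1)) \<theta> :> sphere_gradient H \<xi> \<theta>"
proof -
  let ?c = "measure lborel (cball (0::real ^ 'n) 1)"
  let ?D = "real CARD('n) *\<^sub>R (\<integral>y. indicator (cball 0 1) y *\<^sub>R (H (\<theta> + \<xi> *\<^sub>R sgn y) *\<^sub>R sgn y) \<partial>lborel)"
  have "\<bar>H (\<xi> *\<^sub>R x) - H (\<xi> *\<^sub>R y)\<bar> \<le> \<xi> * L * norm (x - y)" for x y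
    using lip[of "\<xi> *\<^sub>R x" "\<xi> *\<^sub>R y"] xi by (simp add: scaleR_diff_right[symmetric] mult_ac)
  from GDERIV_cball_integral[of "\<lambda>x. H (\<xi> *\<^sub>R x)", OF this, of "(1 / \<xi>) *\<^sub>R \<theta>"]
  have "((\<lambda>t. \<integral>y. indicator (cball 0 1) y * H (\<xi> *\<^sub>R t + \<xi> *\<^sub>R y) \<partial>lborel) has_derivative (\<lambda>h. h \<bullet> ?D)) (at ((1 / \<xi>) *\<^sub>R \<theta>))"
    using xi unfolding gderiv_def by (simp add: scaleR_add_right)
  then have "((\<lambda>\<theta>. \<integral>y. indicator (cball 0 1) y * H (\<xi> *\<^sub>R ((1 / \<xi>) *\<^sub>R \<theta>) + \<xi> *\<^sub>R y) \<partial>lborel)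
      has_derivative (\<lambda>h. ((1 / \<xi>) *\<^sub>R h) \<bullet> ?D)) (at \<theta>)"
    by (rule has_derivative_compose[rotated]) (auto intro!: derivative_eq_intros)
  then have "((\<lambda>\<theta>. (1 / ?c) * (\<integral>y. indicator (cball 0 1) y * H (\<theta> + \<xi> *\<^sub>R y) \<partial>lborel))
      has_derivative (\<lambda>h. (1 / ?c) * (((1 / \<xi>) *\<^sub>R h) \<bullet> ?D))) (at \<theta>)"
    using xi by (intro has_derivative_mult_right) simp
  also have "(\<lambda>\<theta>. (1 / ?c) * (\<integral>y. indicator (cball 0 1) y * H (\<theta> + \<xi> *\<^sub>R y) \<partial>lborel)) =
      (\<lambda>\<theta>. \<integral>\<nu>. H (\<theta> + \<xi> *\<^sub>R \<nu>) \<partial>uniform_measure lborel (cball 0 1))"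
    by (simp add: integral_uniform_measure_cball)
  also have "(\<lambda>h. (1 / ?c) * (((1 / \<xi>) *\<^sub>R h) \<bullet> ?D)) = (\<lambda>h. h \<bullet> sphere_gradient H \<xi> \<theta>)"
    unfolding sphere_gradient_def by (simp add: integral_uniform_sphere inner_scaleR_right mult_ac)
  finally show ?thesis unfolding gderiv_def .
qed

lemma H_increment_bound: "norm u = 1 \<Longrightarrow> \<bar>H (\<theta> + \<xi> *\<^sub>R u) - H \<theta>\<bar> \<le> L * \<xi>"
  using lip[of "\<theta> + \<xi> *\<^sub>R u" \<theta>] xi by simp

lemma integrable_H_sphere: "integrable uniform_sphere (\<lambda>u. H (\<theta> + \<xi> *\<^sub>R u) *\<^sub>R u)"
proof (rule integrable_uniform_sphere)
  show "norm (H (\<theta> + \<xi> *\<^sub>R u) *\<^sub>R u) \<le> \<bar>H \<theta>\<bar> + L * \<xi>" if "norm u = 1" for u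
    using H_increment_bound[OF that, of \<theta>] that by auto
qed simp

lemma sphere_gradient_lipschitz:
  "norm (sphere_gradient H \<xi> a - sphere_gradient H \<xi> b) \<le> real CARD('n) * L / \<xi> * norm (a - b)"
proof -
  interpret S: prob_space "uniform_sphere :: (real ^ 'n) measure" by (rule prob_space_uniform_sphere)
  have "norm (\<integral>u. H (a + \<xi> *\<^sub>R u) *\<^sub>R u - H (b + \<xi> *\<^sub>R u) *\<^sub>R u \<partial>uniform_sphere) \<le>
      (\<integral>u. norm (H (a + \<xi> *\<^sub>R u) *\<^sub>R u - H (b + \<xi> *\<^sub>R u) *\<^sub>R u) \<partial>uniform_sphere)"
    by (rule integral_norm_bound)
  also have "\<dots> \<le> (\<integral>u. L * norm (a - b) \<partial>(uniform_sphere :: (real ^ 'n) measure))"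
  proof (rule integral_mono_AE)
    show "AE u in uniform_sphere. norm (H (a + \<xi> *\<^sub>R u) *\<^sub>R u - H (b + \<xi> *\<^sub>R u) *\<^sub>R u) \<le> L * norm (a - b)"
      using AE_uniform_sphere
    proof eventually_elim
      case (elim u)
      then show ?case
        using lip[of "a + \<xi> *\<^sub>R u" "b + \<xi> *\<^sub>R u"] by (simp add: scaleR_diff_left[symmetric])
    qed
  qed (use integrable_H_sphere in auto)
  finally have "norm ((\<integral>u. H (a + \<xi> *\<^sub>R u) *\<^sub>R u \<partial>uniform_sphere) - (\<integral>u. H (b + \<xi> *\<^sub>R u) *\<^sub>R u \<partial>uniform_sphere)) \<le> L * norm (a - b)"
    using integrable_H_sphere S.prob_space by simp
  then have "real CARD('n) / \<xi> * norm ((\<integral>u. H (a + \<xi> *\<^sub>R u) *\<^sub>R u \<partial>uniform_sphere) - (\<integral>u. H (b + \<xi> *\<^sub>R u) *\<^sub>R u \<partial>uniform_sphere))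
      \<le> real CARD('n) / \<xi> * (L * norm (a - b))"
    using xi by (intro mult_left_mono) auto
  then show ?thesis
    unfolding sphere_gradient_def scaleR_diff_right[symmetric] norm_scaleR using xi by simp
qed

end

text \<open>The ball average of a constant is constant, so \<open>GDERIV_ball_average\<close> gives the mean.\<close>

lemma uniform_sphere_mean_zero: "(\<integral>u. u \<partial>uniform_sphere) = (0 :: real ^ 'n)"
proof -
  interpret lipschitz_objective "\<lambda>_ :: real ^ 'n. 1" 0 1
    by unfold_locales auto
  have "sphere_gradient (\<lambda>_. 1) 1 (0 :: real ^ 'n) = 0"
    by (rule GDERIV_unique[OF GDERIV_ball_average]) (rule GDERIV_const)
  then show ?thesis by (simp add: sphere_gradient_def)
qed

text \<open>Subtracting the constant \<open>H \<theta>\<close> changes nothing because directions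
  average to zero. The gain is an integrand bounded in terms of \<open>L\<close>, uniformly in
  \<open>\<theta>\<close>.\<close>

lemma (in lipschitz_objective) sphere_gradient_increment:
  "sphere_gradient H \<xi> \<theta> = (\<integral>u. (real CARD('n) / \<xi> * (H (\<theta> + \<xi> *\<^sub>R u) - H \<theta>)) *\<^sub>R u \<partial>uniform_sphere)"
proof -
  have 1: "integrable uniform_sphere (\<lambda>u. H \<theta> *\<^sub>R u)"
    by (rule integrable_uniform_sphere[where B = "\<bar>H \<theta>\<bar>"]) auto
  have "(\<integral>u. (real CARD('n) / \<xi> * (H (\<theta> + \<xi> *\<^sub>R u) - H \<theta>)) *\<^sub>R u \<partial>uniform_sphere) =
      (\<integral>u. (real CARD('n) / \<xi>) *\<^sub>R (H (\<theta> + \<xi> *\<^sub>R u) *\<^sub>R u - H \<theta> *\<^sub>R u) \<partial>uniform_sphere)"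
    by (simp add: scaleR_diff_left scaleR_diff_right right_diff_distrib)
  also have "\<dots> = sphere_gradient H \<xi> \<theta>"
    unfolding sphere_gradient_def
    by (simp only: integral_scaleR_right Bochner_Integration.integral_diff[OF integrable_H_sphere 1]
        uniform_sphere_mean_zero scaleR_zero_right diff_zero)
  finally show ?thesis ..
qed

section \<open>First-order conditions\<close>

lemma differentiable_imp_GDERIV_gradient:
  fixes h :: "'a::euclidean_space \<Rightarrow> real"
  assumes "h differentiable (at x)"
  shows "GDERIV h x :> gradient h x"
proof -
  obtain h' where h': "(h has_derivative h') (at x)"
    using assms unfolding differentiable_def by blast
  \<comment> \<open>Riesz representation: the vector that represents the functional is its adjoint
    applied to 1.\<close>
  have "h' = (\<lambda>v. v \<bullet> adjoint h' 1)"
    using adjoint_works[OF has_derivative_linear[OF h']] by auto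
  then have "GDERIV h x :> adjoint h' 1"
    using h' unfolding gderiv_def by metis
  then show ?thesis using gradient_eqI by metis
qed

lemma GDERIV_line:
  assumes "GDERIV h x :> D"
  shows "((\<lambda>s. h (x + s *\<^sub>R d)) has_real_derivative (D \<bullet> d)) (at 0)"
proof -
  have "((\<lambda>s. h (x + s *\<^sub>R d)) has_derivative (\<lambda>r. (r *\<^sub>R d) \<bullet> D)) (at 0)"
    by (rule has_derivative_compose[where g = h]) (use assms in \<open>auto simp: gderiv_def intro!: derivative_eq_intros\<close>)
  then show ?thesis
    unfolding has_field_derivative_def
    by (rule has_derivative_eq_rhs) (auto simp: fun_eq_iff inner_commute)
qed

lemma convex_on_above_tangent_GDERIV:
  assumes conv: "convex_on UNIV h" and D: "GDERIV h x :> D"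
  shows "h x + D \<bullet> (y - x) \<le> h y"
proof -
  let ?\<psi> = "\<lambda>s. h (x + s *\<^sub>R (y - x))"
  have "convex_on UNIV ?\<psi>"
  proof (rule convex_onI)
    fix t a b :: real assume t: "0 < t" "t < 1"
    have "x + ((1 - t) *\<^sub>R a + t *\<^sub>R b) *\<^sub>R (y - x) = (1 - t) *\<^sub>R (x + a *\<^sub>R (y - x)) + t *\<^sub>R (x + b *\<^sub>R (y - x))"
      by (simp add: algebra_simps)
    then show "?\<psi> ((1 - t) *\<^sub>R a + t *\<^sub>R b) \<le> (1 - t) * ?\<psi> a + t * ?\<psi> b"
      using convex_onD[OF conv, of t] t by simp
  qed simp
  from convex_on_imp_above_tangent[OF this, of 0 1 "D \<bullet> (y - x)"] GDERIV_line[OF D, of "y - x"]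
  show ?thesis by simp
qed

lemma GDERIV_nonneg_at_min:
  assumes D: "GDERIV h x :> D" and minimal: "\<And>s. 0 < s \<Longrightarrow> s \<le> 1 \<Longrightarrow> h x \<le> h (x + s *\<^sub>R d)"
  shows "D \<bullet> d \<ge> 0"
proof (rule ccontr)
  assume "\<not> D \<bullet> d \<ge> 0"
  then obtain e where e: "e > 0" "\<And>s. 0 < s \<Longrightarrow> s < e \<Longrightarrow> h (x + (0 + s) *\<^sub>R d) < h (x + 0 *\<^sub>R d)"
    using DERIV_neg_dec_right[OF GDERIV_line[OF D, of d]] by auto
  \<comment> \<open>A step that lies both in the interval of decrease and in the admissible range
    \<open>s \<le> 1\<close>.\<close>
  have "0 < min (e / 2) 1" "min (e / 2) 1 < e" "min (e / 2) 1 \<le> 1"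
    using e(1) by (auto simp: min_def)
  then show False using e(2)[of "min (e / 2) 1"] minimal[of "min (e / 2) 1"] by simp
qed

section \<open>Nash equilibria as solutions of a variational inequality\<close>

lemma block_nth [simp]: "block own i x $ c = (if own c = i then x $ c else 0)"
  by (simp add: block_def)

lemma deviate_nth [simp]: "deviate own i y x $ c = (if own c = i then y $ c else x $ c)"
  by (simp add: deviate_def)

lemma block_strategy: "y \<in> strategy_space own i \<Longrightarrow> block own i y = y"
  by (auto simp: vec_eq_iff strategy_space_def)

lemma bounded_linear_block: "bounded_linear (block own i)"
  unfolding linear_conv_bounded_linear[symmetric]
  by (rule linearI) (auto simp: vec_eq_iff)

lemma sum_block:
  fixes own :: "'d::finite \<Rightarrow> 'p::finite"
  shows "(\<Sum>i\<in>UNIV. block own i x) = x"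
  by (auto simp: vec_eq_iff if_distrib cong: if_cong)

text \<open>\<open>deviate own i y x - x\<close> vanishes outside the coordinates owned by
  \<open>i\<close>, and on these the two gradients agree by construction.\<close>

lemma partial_gradient_inner_deviate:
  "partial_gradient own f i x \<tau> \<bullet> (deviate own i y x - x) = pseudo_gradient own f x \<tau> \<bullet> (deviate own i y x - x)"
  unfolding inner_vec_def by (rule sum.cong) (auto simp: pseudo_gradient_def)

lemma sum_deviate:
  fixes own :: "'d::finite \<Rightarrow> 'p::finite"
  shows "(\<Sum>i\<in>UNIV. deviate own i y x - x) = y - x"
proof -
  have "deviate own i y x - x = block own i (y - x)" for i by (auto simp: vec_eq_iff)
  then show ?thesis by (simp add: sum_block)
qed

locale monotone_game =
  fixes own :: "'d::finite \<Rightarrow> 'p::finite" and X :: "'p \<Rightarrow> (real ^ 'd) set"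
    and f :: "'p \<Rightarrow> real ^ 'd \<Rightarrow> 't \<Rightarrow> real" and \<mu> l :: real
  assumes X_space: "\<And>i. X i \<subseteq> strategy_space own i"
    and X: "\<And>i. X i \<noteq> {} \<and> compact (X i) \<and> convex (X i)"
    and f_diff: "\<And>i x \<tau> z. (\<lambda>y. f i (deviate own i y x) \<tau>) differentiable (at z)"
    and f_convex: "\<And>i x \<tau>. convex_on UNIV (\<lambda>y. f i (deviate own i y x) \<tau>)"
    and mu: "\<mu> > 0"
    and G_mono: "\<And>\<tau> x x'. (pseudo_gradient own f x \<tau> - pseudo_gradient own f x' \<tau>) \<bullet> (x - x')
         \<ge> \<mu> * (norm (x - x'))\<^sup>2"
    and l: "l > 0"
    and G_lip: "\<And>\<tau> x x'. norm (pseudo_gradient own f x \<tau> - pseudo_gradient own f x' \<tau>) \<le> l * norm (x - x')"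
begin

lemma joint_strategies_nonempty: "joint_strategies own X \<noteq> {}"
proof -
  have "\<forall>i. \<exists>y. y \<in> X i" using X by blast
  then obtain y where y: "\<And>i. y i \<in> X i" by metis
  have "block own i (\<chi> c. y (own c) $ c) = y i" for i
    using X_space[of i] y[of i] by (auto simp: vec_eq_iff strategy_space_def)
  then have "(\<chi> c. y (own c) $ c) \<in> joint_strategies own X"
    using y by (simp add: joint_strategies_def)
  then show ?thesis by blast
qed

lemma joint_strategies_eq: "joint_strategies own X = (\<Inter>i. block own i -` X i)"
  by (auto simp: joint_strategies_def)

lemma convex_joint_strategies: "convex (joint_strategies own X)"
  unfolding joint_strategies_eq
  by (intro convex_INT convex_linear_vimage bounded_linear.linear[OF bounded_linear_block]) (use X in auto)

lemma compact_joint_strategies: "compact (joint_strategies own X)"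
proof -
  have "closed (joint_strategies own X)"
    unfolding joint_strategies_eq
    by (intro closed_INT ballI closed_vimage linear_continuous_on bounded_linear_block)
       (use X compact_imp_closed in auto)
  moreover have "bounded (joint_strategies own X)"
  proof -
    have "\<forall>i. \<exists>b. \<forall>x\<in>X i. norm x \<le> b" using X compact_imp_bounded bounded_iff by metis
    then obtain b where b: "\<And>i x. x \<in> X i \<Longrightarrow> norm x \<le> b i" by metis
    have "norm x \<le> (\<Sum>i\<in>UNIV. b i)" if "x \<in> joint_strategies own X" for x
      using that norm_sum[of "\<lambda>i. block own i x" UNIV] sum_mono[of UNIV "\<lambda>i. norm (block own i x)" b] b
      by (simp add: sum_block joint_strategies_def)
    then show ?thesis unfolding bounded_iff by blast
  qed
  ultimately show ?thesis by (simp add: compact_eq_bounded_closed)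
qed

lemma deviate_in_joint_strategies:
  assumes "x \<in> joint_strategies own X" "y \<in> X i"
  shows "deviate own i y x \<in> joint_strategies own X"
proof -
  have "block own j (deviate own i y x) = (if j = i then block own i y else block own j x)" for j
    by (auto simp: vec_eq_iff)
  then show ?thesis
    using assms block_strategy[of y own i] X_space[of i] by (auto simp: joint_strategies_def subset_iff)
qed

lemma partial_gradient_GDERIV:
  "GDERIV (\<lambda>y. f i (deviate own i y x) \<tau>) x :> partial_gradient own f i x \<tau>"
  unfolding partial_gradient_def by (rule differentiable_imp_GDERIV_gradient[OF f_diff])

text \<open>In one direction, each player's first-order condition towards its block of
  \<open>y\<close> is summed over the players. In the other, unilateral deviations are admissible
  test points, and convexity in the own strategy turns the first-order condition into
  optimality.\<close>

lemma is_nash_iff_variational_inequality: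
  "is_nash own X f \<tau> x \<longleftrightarrow> x \<in> joint_strategies own X \<and>
    (\<forall>y\<in>joint_strategies own X. pseudo_gradient own f x \<tau> \<bullet> (y - x) \<ge> 0)"
proof (intro iffI conjI ballI)
  assume nash: "is_nash own X f \<tau> x"
  then show x: "x \<in> joint_strategies own X" by (simp add: is_nash_def)
  fix y assume y: "y \<in> joint_strategies own X"
  have "partial_gradient own f i x \<tau> \<bullet> (deviate own i y x - x) \<ge> 0" for i
  proof (rule GDERIV_nonneg_at_min[OF partial_gradient_GDERIV])
    fix s :: real assume s: "0 < s" "s \<le> 1"
    \<comment> \<open>Convexity of \<open>X i\<close> keeps this mixture feasible. A deviation reads
      only the coordinates owned by \<open>i\<close>, so it coincides with the deviation along the
      segment.\<close>
    let ?w = "(1 - s) *\<^sub>R block own i x + s *\<^sub>R block own i y"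
    have "?w \<in> X i"
      using x y s X[of i] by (intro convexD) (auto simp: joint_strategies_def)
    moreover have "deviate own i ?w x = deviate own i (x + s *\<^sub>R (deviate own i y x - x)) x"
      by (auto simp: vec_eq_iff algebra_simps)
    moreover have "deviate own i x x = x" by (auto simp: vec_eq_iff)
    ultimately show "f i (deviate own i x x) \<tau> \<le> f i (deviate own i (x + s *\<^sub>R (deviate own i y x - x)) x) \<tau>"
      using nash unfolding is_nash_def by metis
  qed
  then have "0 \<le> (\<Sum>i\<in>UNIV. pseudo_gradient own f x \<tau> \<bullet> (deviate own i y x - x))"
    by (intro sum_nonneg) (simp add: partial_gradient_inner_deviate)
  then show "pseudo_gradient own f x \<tau> \<bullet> (y - x) \<ge> 0"
    by (simp add: inner_sum_right[symmetric] sum_deviate)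
next
  assume VI: "x \<in> joint_strategies own X \<and>
    (\<forall>y\<in>joint_strategies own X. pseudo_gradient own f x \<tau> \<bullet> (y - x) \<ge> 0)"
  have "f i x \<tau> \<le> f i (deviate own i y x) \<tau>" if "y \<in> X i" for i y
  proof -
    have "deviate own i x x = x" "deviate own i (deviate own i y x) x = deviate own i y x"
      by (auto simp: vec_eq_iff)
    moreover have "0 \<le> partial_gradient own f i x \<tau> \<bullet> (deviate own i y x - x)"
      using VI deviate_in_joint_strategies[OF _ that] by (simp add: partial_gradient_inner_deviate)
    ultimately show ?thesis
      using convex_on_above_tangent_GDERIV[OF f_convex partial_gradient_GDERIV, of i x \<tau> "deviate own i y x"]
      by simp
  qed
  then show "is_nash own X f \<tau> x" using VI by (simp add: is_nash_def)
qed

lemma ex_nash: "\<exists>x. is_nash own X f \<tau> x"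
proof -
  let ?S = "joint_strategies own X"
  \<comment> \<open>Every positive step length would give the same fixed points, and Brouwer asks
    for no contraction, so the step is 1.\<close>
  let ?T = "\<lambda>x. closest_point ?S (x - pseudo_gradient own f x \<tau>)"
  have S: "convex ?S" "closed ?S" "?S \<noteq> {}"
    using convex_joint_strategies compact_joint_strategies compact_imp_closed joint_strategies_nonempty by auto
  have "continuous_on ?S (\<lambda>x. pseudo_gradient own f x \<tau>)"
    by (rule lipschitz_on_continuous_on[where L = l])
       (use l G_lip in \<open>auto intro!: lipschitz_onI simp: dist_norm\<close>)
  then have "continuous_on ?S ?T"
    by (intro continuous_on_compose2[OF continuous_on_closest_point[OF S, of UNIV]] continuous_intros) auto
  then obtain x where x: "x \<in> ?S" "?T x = x"
    using brouwer[OF compact_joint_strategies S(1,3), of ?T] closest_point_in_set[OF S(2,3)] by auto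
  \<comment> \<open>At a fixed point the obtuse-angle property of the projection is the variational
    inequality.\<close>
  have "pseudo_gradient own f x \<tau> \<bullet> (y - x) \<ge> 0" if "y \<in> ?S" for y
    using closest_point_dot[OF S(1,2) that, of "x - pseudo_gradient own f x \<tau>"] x(2) by simp
  then show ?thesis using x(1) is_nash_iff_variational_inequality by blast
qed

lemma is_nash_unique:
  assumes "is_nash own X f \<tau> x" "is_nash own X f \<tau> y"
  shows "x = y"
proof -
  have "pseudo_gradient own f x \<tau> \<bullet> (y - x) \<ge> 0" "pseudo_gradient own f y \<tau> \<bullet> (x - y) \<ge> 0"
    using assms by (auto simp: is_nash_iff_variational_inequality)
  then have "(pseudo_gradient own f x \<tau> - pseudo_gradient own f y \<tau>) \<bullet> (x - y) \<le> 0"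
    by (simp add: inner_diff_left inner_diff_right)
  then have "\<mu> * (norm (x - y))\<^sup>2 \<le> 0" using G_mono order_trans by blast
  then show ?thesis using mu by (simp add: mult_le_0_iff)
qed

lemma is_nash_nash: "is_nash own X f \<tau> (nash own X f \<tau>)"
  unfolding nash_def using ex_nash is_nash_unique by (metis theI)

lemma nash_in_joint_strategies: "nash own X f \<tau> \<in> joint_strategies own X"
  using is_nash_nash by (simp add: is_nash_def)

text \<open>The Lipschitz bound in the strategies is available only on joint strategies, so the
  approximate equilibrium must be feasible. Own strategies are feasible initially and after each
  projection; the output collects these and drops the estimates, which may be infeasible.\<close>

lemma inner_output_in_joint_strategies:
  assumes x0: "\<And>i. block own i (x0 i) \<in> X i"
  shows "inner_output own X f A \<gamma> x0 t \<tau> \<in> joint_strategies own X"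
proof -
  have "block own i (inner_iter own X f A \<gamma> x0 \<tau> t i) \<in> X i" for i
  proof (cases t)
    case (Suc s)
    have "closest_point (X i) z \<in> X i" for z
      using X[of i] compact_imp_closed closest_point_in_set by blast
    moreover from this have "block own i (deviate own i (closest_point (X i) z) w) = closest_point (X i) z" for z w
      using X_space[of i] by (auto simp: vec_eq_iff strategy_space_def)
    ultimately show ?thesis using Suc by (simp add: Let_def)
  qed (simp add: x0)
  moreover have "block own i (inner_output own X f A \<gamma> x0 t \<tau>) = block own i (inner_iter own X f A \<gamma> x0 \<tau> t i)" for i
    by (auto simp: vec_eq_iff inner_output_def)
  ultimately show ?thesis by (simp add: joint_strategies_def)
qed

end

section \<open>One descent step in deterministic form\<close>

text \<open>The right-hand side is affine in the exact estimator \<open>h\<close>, whose conditional mean is known.\<close>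

lemma descent_step_bound:
  fixes h e p g :: "'a::real_inner" and \<alpha> \<Lambda> B b :: real
  assumes a: "\<alpha> > 0" and \<Lambda>: "\<Lambda> \<ge> 0" "\<Lambda> * \<alpha> \<le> 1 / 4" and h: "norm h \<le> B" and e: "norm e \<le> b"
  shows "g \<bullet> (- \<alpha> *\<^sub>R (h + e + p)) + \<Lambda> / 2 * (norm (- \<alpha> *\<^sub>R (h + e + p)))\<^sup>2 \<le>
    ((2 * \<Lambda> * \<alpha>\<^sup>2) *\<^sub>R p - \<alpha> *\<^sub>R g) \<bullet> h
    + (- \<alpha> * (g \<bullet> p) + \<Lambda> * \<alpha>\<^sup>2 * (norm p)\<^sup>2 + \<alpha> / 4 * (norm g)\<^sup>2 + \<Lambda> * \<alpha>\<^sup>2 * B\<^sup>2 + 5 / 4 * \<alpha> * b\<^sup>2)"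
proof -
  have B: "(norm h)\<^sup>2 \<le> B\<^sup>2" and b: "(norm e)\<^sup>2 \<le> b\<^sup>2"
    using h e by (auto intro: power_mono)
  \<comment> \<open>Young's inequality with weights 1/4 and 1; a quarter of the squared gradient is
    spent here.\<close>
  have 1: "- (g \<bullet> e) \<le> 1 / 4 * (norm g)\<^sup>2 + (norm e)\<^sup>2"
  proof -
    have "0 \<le> (norm ((1 / 2) *\<^sub>R g + e))\<^sup>2" by simp
    then show ?thesis
      unfolding power2_norm_eq_inner by (simp add: inner_add_left inner_add_right inner_commute)
  qed
  \<comment> \<open>Only \<open>e\<close> is split off. The cross term of \<open>p\<close> and
    \<open>h\<close> is kept exactly: it is linear in \<open>h\<close> and completes a square once
    \<open>h\<close> is averaged.\<close>
  have 2: "(norm (h + e + p))\<^sup>2 \<le> 2 * ((norm h)\<^sup>2 + 2 * (p \<bullet> h) + (norm p)\<^sup>2) + 2 * (norm e)\<^sup>2"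
  proof -
    have "0 \<le> (norm (h + p - e))\<^sup>2" by simp
    then show ?thesis
      unfolding power2_norm_eq_inner
      by (simp add: inner_add_left inner_add_right inner_diff_left inner_diff_right inner_commute)
  qed
  have "\<Lambda> * \<alpha>\<^sup>2 * (norm e)\<^sup>2 = (\<Lambda> * \<alpha>) * (\<alpha> * (norm e)\<^sup>2)" by (simp add: power2_eq_square)
  also have "\<dots> \<le> 1 / 4 * (\<alpha> * (norm e)\<^sup>2)"
    using \<Lambda>(2) a by (intro mult_right_mono) auto
  \<comment> \<open>Together with the coefficient 1 from Young's inequality, this 1/4 makes up the
    5/4 of the conclusion.\<close>
  finally have 3: "\<Lambda> * \<alpha>\<^sup>2 * (norm e)\<^sup>2 \<le> 1 / 4 * (\<alpha> * (norm e)\<^sup>2)" .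
  \<comment> \<open>The square of \<open>h\<close>, the only term that is not affine in
    \<open>h\<close>, gives way to its bound.\<close>
  have 4: "\<Lambda> / 2 * \<alpha>\<^sup>2 * (norm (h + e + p))\<^sup>2 \<le>
      \<Lambda> / 2 * \<alpha>\<^sup>2 * (2 * (B\<^sup>2 + 2 * (p \<bullet> h) + (norm p)\<^sup>2) + 2 * (norm e)\<^sup>2)"
    using 2 B \<Lambda> by (intro mult_left_mono) auto
  have 5: "\<alpha> * (- (g \<bullet> e)) \<le> \<alpha> * (1 / 4 * (norm g)\<^sup>2 + (norm e)\<^sup>2)"
    using 1 a by (intro mult_left_mono) auto
  have 6: "\<alpha> * (norm e)\<^sup>2 \<le> \<alpha> * b\<^sup>2" using b a by (intro mult_left_mono) auto
  have "g \<bullet> (- \<alpha> *\<^sub>R (h + e + p)) + \<Lambda> / 2 * (norm (- \<alpha> *\<^sub>R (h + e + p)))\<^sup>2 =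
      - \<alpha> * (g \<bullet> h) - \<alpha> * (g \<bullet> p) + \<alpha> * (- (g \<bullet> e)) + \<Lambda> / 2 * \<alpha>\<^sup>2 * (norm (h + e + p))\<^sup>2"
    unfolding norm_scaleR power_mult_distrib by (simp add: inner_add_right algebra_simps)
  also have "\<dots> \<le> - \<alpha> * (g \<bullet> h) - \<alpha> * (g \<bullet> p) + \<alpha> / 4 * (norm g)\<^sup>2 + \<Lambda> * \<alpha>\<^sup>2 * (B\<^sup>2 + 2 * (p \<bullet> h) + (norm p)\<^sup>2) + 5 / 4 * (\<alpha> * b\<^sup>2)"
    using 3 4 5 6 by (simp add: algebra_simps)
  also have "\<dots> = ((2 * \<Lambda> * \<alpha>\<^sup>2) *\<^sub>R p - \<alpha> *\<^sub>R g) \<bullet> h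
    + (- \<alpha> * (g \<bullet> p) + \<Lambda> * \<alpha>\<^sup>2 * (norm p)\<^sup>2 + \<alpha> / 4 * (norm g)\<^sup>2 + \<Lambda> * \<alpha>\<^sup>2 * B\<^sup>2 + 5 / 4 * \<alpha> * b\<^sup>2)"
    by (simp add: inner_diff_left algebra_simps)
  finally show ?thesis .
qed

text \<open>With the estimator replaced by its mean \<open>s\<close> and the gradient equal to
  \<open>s + p\<close>, the curvature terms complete \<open>(norm (s + p))\<^sup>2\<close> minus
  \<open>(norm s)\<^sup>2\<close>. In units of \<alpha>, the coefficient of the squared gradient is
  -1 from the step, +1/4 from Young's inequality and at most +1/4 from the curvature.\<close>

lemma descent_step_mean:
  fixes p s :: "'a::real_inner" and \<alpha> \<Lambda> :: real
  assumes a: "\<alpha> > 0" and \<Lambda>: "\<Lambda> \<ge> 0" "\<Lambda> * \<alpha> \<le> 1 / 4"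
  shows "((2 * \<Lambda> * \<alpha>\<^sup>2) *\<^sub>R p - \<alpha> *\<^sub>R (s + p)) \<bullet> s
    + (- \<alpha> * ((s + p) \<bullet> p) + \<Lambda> * \<alpha>\<^sup>2 * (norm p)\<^sup>2 + \<alpha> / 4 * (norm (s + p))\<^sup>2) \<le> - (\<alpha> / 2) * (norm (s + p))\<^sup>2"
proof -
  have "\<Lambda> * \<alpha>\<^sup>2 * (norm (s + p))\<^sup>2 = (\<Lambda> * \<alpha>) * (\<alpha> * (norm (s + p))\<^sup>2)" by (simp add: power2_eq_square)
  also have "\<dots> \<le> 1 / 4 * (\<alpha> * (norm (s + p))\<^sup>2)"
    using \<Lambda>(2) a by (intro mult_right_mono) auto
  finally have 1: "\<Lambda> * \<alpha>\<^sup>2 * (norm (s + p))\<^sup>2 \<le> 1 / 4 * (\<alpha> * (norm (s + p))\<^sup>2)" .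
  have 2: "0 \<le> \<Lambda> * \<alpha>\<^sup>2 * (norm s)\<^sup>2" using \<Lambda> by simp
  have "((2 * \<Lambda> * \<alpha>\<^sup>2) *\<^sub>R p - \<alpha> *\<^sub>R (s + p)) \<bullet> s
    + (- \<alpha> * ((s + p) \<bullet> p) + \<Lambda> * \<alpha>\<^sup>2 * (norm p)\<^sup>2 + \<alpha> / 4 * (norm (s + p))\<^sup>2) =
    \<Lambda> * \<alpha>\<^sup>2 * (norm (s + p))\<^sup>2 - \<Lambda> * \<alpha>\<^sup>2 * (norm s)\<^sup>2 - 3 / 4 * (\<alpha> * (norm (s + p))\<^sup>2)"
    unfolding power2_norm_eq_inner
    by (simp add: inner_add_left inner_add_right inner_diff_left inner_commute algebra_simps)
  then show ?thesis using 1 2 by linarith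
qed

section \<open>The penalized ball average and its exact estimator\<close>

context lipschitz_objective
begin

text \<open>When \<open>H\<close> is the sum of the player objectives, this is what the algorithm
  would compute from exact equilibria.\<close>

definition sphere_estimate :: "real ^ 'n \<Rightarrow> real ^ 'n \<Rightarrow> real ^ 'n" where
  "sphere_estimate u \<theta> = (real CARD('n) / \<xi> * (H (\<theta> + \<xi> *\<^sub>R u) - H \<theta>)) *\<^sub>R u"

text \<open>The increment over a step of length \<open>\<xi>\<close> cancels
  \<open>1 / \<xi>\<close>. The square of this bound is the origin of the factor
  \<open>N\<^sup>2 n\<^sup>2 L\<^sub>F\<^sup>2\<close> in the final estimate.\<close>

lemma norm_sphere_estimate: "norm u = 1 \<Longrightarrow> norm (sphere_estimate u \<theta>) \<le> real CARD('n) * L"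
  using mult_left_mono[OF H_increment_bound[of u \<theta>], of "real CARD('n) / \<xi>"] xi
  by (simp add: sphere_estimate_def abs_mult)

lemma continuous_sphere_estimate:
  "continuous_on UNIV (\<lambda>z. sphere_estimate (snd z) (fst z))"
  unfolding sphere_estimate_def
  by (intro continuous_intros continuous_on_compose2[OF continuous_H]) auto

lemma integrable_sphere_estimate: "integrable uniform_sphere (\<lambda>u. sphere_estimate u \<theta>)"
proof (rule integrable_uniform_sphere)
  show "(\<lambda>u. sphere_estimate u \<theta>) \<in> borel_measurable borel"
    unfolding sphere_estimate_def by measurable
qed (rule norm_sphere_estimate)

lemma integral_sphere_estimate: "(\<integral>u. sphere_estimate u \<theta> \<partial>uniform_sphere) = sphere_gradient H \<xi> \<theta>"
  unfolding sphere_estimate_def by (rule sphere_gradient_increment[symmetric])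

definition penalty_gradient :: "(real ^ 'n) set \<Rightarrow> real ^ 'n \<Rightarrow> real ^ 'n" where
  "penalty_gradient S \<theta> = (1 / \<xi>) *\<^sub>R (\<theta> - closest_point S \<theta>)"

definition penalized_average :: "(real ^ 'n) set \<Rightarrow> real ^ 'n \<Rightarrow> real" where
  "penalized_average S \<theta> =
    (\<integral>\<nu>. H (\<theta> + \<xi> *\<^sub>R \<nu>) \<partial>uniform_measure lborel (cball 0 1)) + (infdist \<theta> S)\<^sup>2 / (2 * \<xi>)"

definition penalized_gradient :: "(real ^ 'n) set \<Rightarrow> real ^ 'n \<Rightarrow> real ^ 'n" where
  "penalized_gradient S \<theta> = sphere_gradient H \<xi> \<theta> + penalty_gradient S \<theta>"

lemma GDERIV_penalized_average:
  assumes "closed S" "S \<noteq> {}" "convex S"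
  shows "GDERIV (penalized_average S) \<theta> :> penalized_gradient S \<theta>"
proof -
  have "GDERIV (\<lambda>\<theta>. (1 / (2 * \<xi>)) * (infdist \<theta> S)\<^sup>2) \<theta> :>
      (1 / (2 * \<xi>)) *\<^sub>R (2 *\<^sub>R (\<theta> - closest_point S \<theta>))"
    using has_derivative_mult_right[OF GDERIV_infdist_square[OF assms, of \<theta>, unfolded gderiv_def], of "1 / (2 * \<xi>)"]
    unfolding gderiv_def by simp
  then have "GDERIV (\<lambda>\<theta>. (infdist \<theta> S)\<^sup>2 / (2 * \<xi>)) \<theta> :> penalty_gradient S \<theta>"
    by (simp add: penalty_gradient_def)
  then show ?thesis
    unfolding penalized_average_def[abs_def] penalized_gradient_def
    by (intro GDERIV_add GDERIV_ball_average)
qed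

text \<open>Curvatures add: \<open>real CARD('n) * L / \<xi>\<close> from the ball average and
  \<open>1 / \<xi>\<close> from the penalty, whence the summand 1 in the stepsize condition.\<close>

lemma penalized_average_upper_bound:
  assumes "closed S" "S \<noteq> {}"
  shows "penalized_average S y \<le> penalized_average S x + penalized_gradient S x \<bullet> (y - x)
    + (real CARD('n) * L + 1) / \<xi> / 2 * (norm (y - x))\<^sup>2"
proof -
  have "(infdist y S)\<^sup>2 / (2 * \<xi>) \<le>
      ((infdist x S)\<^sup>2 + 2 * ((x - closest_point S x) \<bullet> (y - x)) + (norm (y - x))\<^sup>2) / (2 * \<xi>)"
    using infdist_square_upper_bound[OF assms, of y x] xi by (intro divide_right_mono) auto
  also have "\<dots> = (infdist x S)\<^sup>2 / (2 * \<xi>) + penalty_gradient S x \<bullet> (y - x) + 1 / \<xi> / 2 * (norm (y - x))\<^sup>2"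
    by (simp add: penalty_gradient_def add_divide_distrib)
  finally show ?thesis
    using lipschitz_gradient_upper_bound[OF GDERIV_ball_average sphere_gradient_lipschitz, of y x]
    unfolding penalized_average_def penalized_gradient_def inner_add_left add_divide_distrib distrib_right
    by linarith
qed

lemma continuous_on_penalty_gradient:
  assumes "closed S" "S \<noteq> {}" "convex S"
  shows "continuous_on A (penalty_gradient S)"
  unfolding penalty_gradient_def by (intro continuous_intros continuous_on_closest_point assms)

lemma continuous_on_sphere_gradient: "continuous_on A (sphere_gradient H \<xi>)"
proof (rule lipschitz_on_continuous_on[where L = "real CARD('n) * L / \<xi>"], rule lipschitz_onI)
  show "dist (sphere_gradient H \<xi> a) (sphere_gradient H \<xi> b) \<le> real CARD('n) * L / \<xi> * dist a b" for a b
    unfolding dist_norm by (rule sphere_gradient_lipschitz)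
qed (use L xi in simp)

lemma continuous_on_penalized_gradient:
  "closed S \<Longrightarrow> S \<noteq> {} \<Longrightarrow> convex S \<Longrightarrow> continuous_on A (penalized_gradient S)"
  unfolding penalized_gradient_def
  by (intro continuous_intros continuous_on_sphere_gradient continuous_on_penalty_gradient)

lemma continuous_on_penalized_average:
  "closed S \<Longrightarrow> S \<noteq> {} \<Longrightarrow> convex S \<Longrightarrow> continuous_on A (penalized_average S)"
  using GDERIV_penalized_average unfolding gderiv_def
  by (meson continuous_at_imp_continuous_on has_derivative_continuous)

end

section \<open>The inexact iteration as a stochastic process\<close>

text \<open>Of the game there remains an error sequence \<open>e\<close>, not assumed measurable,
  with deterministic bounds \<open>b\<close>. The bound is conditional on
  \<open>norm (u k \<omega>) = 1\<close> because in the application the error is a multiple of the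
  direction.\<close>

locale inexact_descent = lipschitz_objective H L \<xi> + prob_space M
  for H :: "real ^ 'n::finite \<Rightarrow> real" and L \<xi> :: real and M :: "'w measure" +
  fixes S :: "(real ^ 'n) set" and \<theta>0 :: "real ^ 'n" and \<alpha> :: real and K :: nat
    and u \<theta> e :: "nat \<Rightarrow> 'w \<Rightarrow> real ^ 'n" and b :: "nat \<Rightarrow> real"
  assumes S: "closed S" "S \<noteq> {}" "convex S"
    and alpha: "\<alpha> > 0" "\<alpha> \<le> \<xi> / (4 * (real CARD('n) * L + 1))"
    and u_uniform: "\<And>k. k < K \<Longrightarrow> distr M borel (u k) = uniform_sphere"
    and u_indep: "\<And>k. k < K \<Longrightarrow> indep_set (past M \<theta> u k) {u k -` B \<inter> space M | B. B \<in> sets borel}"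
    and theta_init: "\<theta>0 \<in> S" "\<And>\<omega>. \<omega> \<in> space M \<Longrightarrow> \<theta> 0 \<omega> = \<theta>0"
    and theta_step: "\<And>k \<omega>. k < K \<Longrightarrow> \<omega> \<in> space M \<Longrightarrow>
      \<theta> (Suc k) \<omega> = \<theta> k \<omega> - \<alpha> *\<^sub>R (sphere_estimate (u k \<omega>) (\<theta> k \<omega>) + e k \<omega> + penalty_gradient S (\<theta> k \<omega>))"
    and error_sphere: "\<And>k. k < K \<Longrightarrow> AE \<omega> in M. norm (u k \<omega>) = 1 \<longrightarrow> norm (e k \<omega>) \<le> b k"
begin

definition "smoothness = (real CARD('n) * L + 1) / \<xi>"

lemma smoothness: "smoothness \<ge> 0" "smoothness * \<alpha> \<le> 1 / 4"
proof -
  have "real CARD('n) * L + 1 > 0" using L by (simp add: add_nonneg_pos)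
  then show "smoothness \<ge> 0" "smoothness * \<alpha> \<le> 1 / 4"
    using xi alpha by (auto simp: smoothness_def field_simps)
qed

text \<open>Measurability is contained in independence: independent families consist of events, and
  the past at \<open>k\<close> contains all preimages of Borel sets under \<open>\<theta> k\<close>.
  The argument stops at \<open>k < K\<close>.\<close>

lemma measurable_theta: "k < K \<Longrightarrow> \<theta> k \<in> borel_measurable M"
  and measurable_u: "k < K \<Longrightarrow> u k \<in> borel_measurable M"
proof -
  assume k: "k < K"
  have "\<theta> k -` B \<inter> space M \<in> events" if "B \<in> sets borel" for B
    using indep_setD_ev1[OF u_indep[OF k]] that unfolding past_def by (blast intro: sigma_sets.Basic)
  then show "\<theta> k \<in> borel_measurable M" by (intro measurableI) auto
  have "u k -` B \<inter> space M \<in> events" if "B \<in> sets borel" for B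
    by (rule subsetD[OF indep_setD_ev2[OF u_indep[OF k]]], rule CollectI, rule exI[of _ B]) (simp add: that)
  then show "u k \<in> borel_measurable M" by (intro measurableI) auto
qed

lemma AE_norm_u: assumes k: "k < K" shows "AE \<omega> in M. norm (u k \<omega>) = 1"
proof -
  have "AE v in distr M borel (u k). norm v = 1"
    unfolding u_uniform[OF k] by (rule AE_uniform_sphere)
  then show ?thesis by (rule AE_distrD[OF measurable_u[OF k]])
qed

lemma error: "k < K \<Longrightarrow> AE \<omega> in M. norm (e k \<omega>) \<le> b k"
  using AE_norm_u[of k] error_sphere[of k] by (auto elim: AE_mp)

text \<open>Estimator and error are bounded, and the penalty gradient is at most the distance from
  \<open>\<theta>0\<close> divided by \<open>\<xi>\<close>, because
  \<open>\<theta>0 \<in> S\<close>. Almost sure boundedness is what makes continuous functions of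
  \<open>\<theta> k\<close> and \<open>u k\<close> integrable.\<close>

lemma theta_bounded: "k \<le> K \<Longrightarrow> \<exists>R. AE \<omega> in M. norm (\<theta> k \<omega> - \<theta>0) \<le> R"
proof (induction k)
  case 0
  then show ?case using theta_init(2) by (intro exI[of _ 0]) (auto intro: AE_I2)
next
  case (Suc k)
  then have k: "k < K" by simp
  obtain R where "AE \<omega> in M. norm (\<theta> k \<omega> - \<theta>0) \<le> R" using Suc by auto
  then have "AE \<omega> in M. norm (\<theta> (Suc k) \<omega> - \<theta>0) \<le> R + \<alpha> * (real CARD('n) * L + b k + R / \<xi>)"
    using AE_norm_u[OF k] error[OF k] AE_space
  proof eventually_elim
    case (elim \<omega>)
    let ?h = "sphere_estimate (u k \<omega>) (\<theta> k \<omega>)" and ?p = "penalty_gradient S (\<theta> k \<omega>)"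
    have "norm ?p = infdist (\<theta> k \<omega>) S / \<xi>"
      using xi by (simp add: penalty_gradient_def infdist_closest_point[OF S(1,2)])
    also have "\<dots> \<le> R / \<xi>"
      using infdist_le[OF theta_init(1), of "\<theta> k \<omega>"] elim(1) xi
      by (intro divide_right_mono) (auto simp: dist_norm)
    finally have "norm (?h + e k \<omega> + ?p) \<le> real CARD('n) * L + b k + R / \<xi>"
      using norm_sphere_estimate[OF elim(2), of "\<theta> k \<omega>"] elim(3)
        norm_triangle_ineq[of "?h + e k \<omega>" ?p] norm_triangle_ineq[of ?h "e k \<omega>"] by linarith
    then have "norm (\<alpha> *\<^sub>R (?h + e k \<omega> + ?p)) \<le> \<alpha> * (real CARD('n) * L + b k + R / \<xi>)"
      using alpha by simp
    moreover have "\<theta> (Suc k) \<omega> - \<theta>0 = (\<theta> k \<omega> - \<theta>0) - \<alpha> *\<^sub>R (?h + e k \<omega> + ?p)"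
      using theta_step[OF k elim(4)] by simp
    then have "norm (\<theta> (Suc k) \<omega> - \<theta>0) \<le> norm (\<theta> k \<omega> - \<theta>0) + norm (\<alpha> *\<^sub>R (?h + e k \<omega> + ?p))"
      by (metis norm_triangle_ineq4)
    ultimately show ?case using elim(1) by linarith
  qed
  then show ?case by blast
qed

lemma integrable_theta_u:
  fixes \<Phi> :: "(real ^ 'n) \<times> (real ^ 'n) \<Rightarrow> real"
  assumes k: "k < K" and \<Phi>: "continuous_on UNIV \<Phi>"
  shows "integrable M (\<lambda>\<omega>. \<Phi> (\<theta> k \<omega>, u k \<omega>))"
proof -
  note [measurable] = measurable_theta[OF k] measurable_u[OF k] borel_measurable_continuous_onI[OF \<Phi>]
  obtain R where R: "AE \<omega> in M. norm (\<theta> k \<omega> - \<theta>0) \<le> R" using theta_bounded[of k] k by auto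
  have "compact (\<Phi> ` (cball \<theta>0 R \<times> cball 0 1))"
    by (intro compact_continuous_image compact_Times continuous_on_subset[OF \<Phi>]) auto
  then obtain B where B: "\<And>z. z \<in> cball \<theta>0 R \<times> cball 0 1 \<Longrightarrow> norm (\<Phi> z) \<le> B"
    using compact_imp_bounded bounded_iff by (metis imageI)
  show ?thesis
  proof (rule integrable_const_bound[of _ B])
    show "AE \<omega> in M. norm (\<Phi> (\<theta> k \<omega>, u k \<omega>)) \<le> B"
      using R AE_norm_u[OF k]
      by eventually_elim (rule B, auto simp: dist_norm norm_minus_commute)
  qed measurable
qed

lemma integrable_theta:
  fixes \<phi> :: "real ^ 'n \<Rightarrow> real"
  assumes "k < K" "continuous_on UNIV \<phi>"
  shows "integrable M (\<lambda>\<omega>. \<phi> (\<theta> k \<omega>))"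
proof -
  have "continuous_on UNIV (\<lambda>z. \<phi> (fst z) :: real)"
    by (rule continuous_on_compose2[OF assms(2)]) (auto intro: continuous_on_fst continuous_on_id)
  from integrable_theta_u[OF assms(1) this] show ?thesis by simp
qed

lemma distr_theta_u:
  assumes k: "k < K"
  shows "distr M (borel \<Otimes>\<^sub>M borel) (\<lambda>\<omega>. (\<theta> k \<omega>, u k \<omega>)) = distr M borel (\<theta> k) \<Otimes>\<^sub>M uniform_sphere"
proof -
  \<comment> \<open>Independence from the whole past is restricted to the sigma-algebra of
    \<open>\<theta> k\<close>.\<close>
  have "sigma_sets (space M) {\<theta> k -` A \<inter> space M |A. A \<in> sets borel} \<subseteq> past M \<theta> u k"
    unfolding past_def by (rule sigma_sets_mono') blast
  \<comment> \<open>Preimages of Borel sets under a single map already form a sigma-algebra.\<close>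
  moreover have "sigma_sets (space M) {u k -` A \<inter> space M |A. A \<in> sets borel} = {u k -` A \<inter> space M |A. A \<in> sets borel}"
    using sets_vimage_algebra[of "space M" "u k" borel] sets_vimage_algebra2[of "u k" "space M" borel] by simp
  ultimately have "indep_set (sigma_sets (space M) {\<theta> k -` A \<inter> space M |A. A \<in> sets borel})
      (sigma_sets (space M) {u k -` A \<inter> space M |A. A \<in> sets borel})"
    using u_indep[OF k] unfolding indep_set_def
    by (elim indep_sets_mono_sets) (auto split: bool.split)
  then have "indep_var borel (\<theta> k) borel (u k)"
    using measurable_theta[OF k] measurable_u[OF k] by (simp add: indep_var_eq)
  then show ?thesis by (simp add: indep_var_distribution_eq u_uniform[OF k])
qed

text \<open>Fubini on the product law takes the place of a conditional expectation: for a frozen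
  iterate the integral over directions is the sphere gradient. The weight \<open>a\<close> may
  depend on the iterate but not on the direction, as in the affine step bound.\<close>

lemma expectation_sphere_estimate:
  assumes k: "k < K" and a: "continuous_on UNIV a"
  shows "expectation (\<lambda>\<omega>. a (\<theta> k \<omega>) \<bullet> sphere_estimate (u k \<omega>) (\<theta> k \<omega>)) =
    expectation (\<lambda>\<omega>. a (\<theta> k \<omega>) \<bullet> sphere_gradient H \<xi> (\<theta> k \<omega>))"
proof -
  let ?\<Phi> = "\<lambda>z. a (fst z) \<bullet> sphere_estimate (snd z) (fst z)"
  let ?D = "distr M borel (\<theta> k)"
  note [measurable] = measurable_theta[OF k] measurable_u[OF k]
  have \<Phi>: "continuous_on UNIV ?\<Phi>"
    by (intro continuous_on_inner continuous_sphere_estimate continuous_on_compose2[OF a] continuous_intros) auto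
  have [measurable]: "?\<Phi> \<in> borel_measurable (borel \<Otimes>\<^sub>M borel)"
    using borel_measurable_continuous_onI[OF \<Phi>] by (simp add: borel_prod)
  interpret D: prob_space ?D by (rule prob_space_distr) measurable
  interpret U: prob_space "uniform_sphere :: (real ^ 'n) measure" by (rule prob_space_uniform_sphere)
  interpret P: pair_sigma_finite ?D "uniform_sphere :: (real ^ 'n) measure" ..
  have int: "integrable (?D \<Otimes>\<^sub>M uniform_sphere) ?\<Phi>"
    unfolding distr_theta_u[OF k, symmetric]
    by (subst integrable_distr_eq) (use integrable_theta_u[OF k \<Phi>] in auto)
  have "expectation (\<lambda>\<omega>. ?\<Phi> (\<theta> k \<omega>, u k \<omega>)) = integral\<^sup>L (?D \<Otimes>\<^sub>M uniform_sphere) ?\<Phi>"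
    unfolding distr_theta_u[OF k, symmetric] by (subst integral_distr) auto
  also have "\<dots> = (\<integral>x. (\<integral>v. ?\<Phi> (x, v) \<partial>uniform_sphere) \<partial>?D)"
    using P.integral_fst'[OF int] by simp
  also have "\<dots> = (\<integral>x. a x \<bullet> sphere_gradient H \<xi> x \<partial>?D)"
    by (simp add: integral_sphere_estimate[symmetric] integrable_sphere_estimate)
  also have "\<dots> = expectation (\<lambda>\<omega>. a (\<theta> k \<omega>) \<bullet> sphere_gradient H \<xi> (\<theta> k \<omega>))"
    using borel_measurable_continuous_onI[OF a] borel_measurable_continuous_onI[OF continuous_on_sphere_gradient]
    by (intro integral_distr) measurable
  finally show ?thesis by simp
qed

lemma integrable_norm_gradient:
  "k < K \<Longrightarrow> integrable M (\<lambda>\<omega>. (norm (penalized_gradient S (\<theta> k \<omega>)))\<^sup>2)"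
  by (rule integrable_theta[of k "\<lambda>x. (norm (penalized_gradient S x))\<^sup>2"])
     (auto intro!: continuous_intros continuous_on_penalized_gradient S)

text \<open>The iterate \<open>\<theta> K\<close> need not be measurable, so the decrease is stated for any integrable minorant.\<close>

lemma expected_descent:
  assumes k: "k < K" and Z: "integrable M Z" "AE \<omega> in M. Z \<omega> \<le> penalized_average S (\<theta> (Suc k) \<omega>)"
  shows "expectation Z \<le> expectation (\<lambda>\<omega>. penalized_average S (\<theta> k \<omega>))
    - \<alpha> / 2 * expectation (\<lambda>\<omega>. (norm (penalized_gradient S (\<theta> k \<omega>)))\<^sup>2)
    + (smoothness * \<alpha>\<^sup>2 * (real CARD('n) * L)\<^sup>2 + 5 / 4 * \<alpha> * (b k)\<^sup>2)"
proof -
  let ?g = "penalized_gradient S" and ?p = "penalty_gradient S" and ?s = "sphere_gradient H \<xi>"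
  let ?h = "\<lambda>\<omega>. sphere_estimate (u k \<omega>) (\<theta> k \<omega>)"
  \<comment> \<open>\<open>a\<close> and \<open>r\<close> are the coefficient of the estimator and
    the estimator-free part in \<open>descent_step_bound\<close>, read as continuous functions of
    the iterate.\<close>
  define a where "a x = (2 * smoothness * \<alpha>\<^sup>2) *\<^sub>R ?p x - \<alpha> *\<^sub>R ?g x" for x
  define r where "r x = - \<alpha> * (?g x \<bullet> ?p x) + smoothness * \<alpha>\<^sup>2 * (norm (?p x))\<^sup>2 + \<alpha> / 4 * (norm (?g x))\<^sup>2" for x
  define c where "c = smoothness * \<alpha>\<^sup>2 * (real CARD('n) * L)\<^sup>2 + 5 / 4 * \<alpha> * (b k)\<^sup>2"
  note cont = continuous_on_penalized_gradient[OF S] continuous_on_penalty_gradient[OF S]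
    continuous_on_sphere_gradient continuous_on_penalized_average[OF S]
  have a: "continuous_on UNIV a" unfolding a_def by (intro continuous_intros cont)
  have r: "continuous_on UNIV r" unfolding r_def by (intro continuous_intros cont)
  have int_F: "integrable M (\<lambda>\<omega>. penalized_average S (\<theta> k \<omega>))"
    by (intro integrable_theta k cont)
  have int_r: "integrable M (\<lambda>\<omega>. r (\<theta> k \<omega>))"
    by (intro integrable_theta k r)
  have int_h: "integrable M (\<lambda>\<omega>. a (\<theta> k \<omega>) \<bullet> ?h \<omega>)"
  proof -
    have "continuous_on UNIV (\<lambda>z. a (fst z) \<bullet> sphere_estimate (snd z) (fst z))"
      by (intro continuous_on_inner continuous_sphere_estimate continuous_on_compose2[OF a] continuous_intros) auto
    from integrable_theta_u[OF k this] show ?thesis by (simp only: fst_conv snd_conv)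
  qed
  have int_s: "integrable M (\<lambda>\<omega>. a (\<theta> k \<omega>) \<bullet> ?s (\<theta> k \<omega>))"
    by (rule integrable_theta[OF k, of "\<lambda>x. a x \<bullet> ?s x"]) (intro continuous_on_inner a cont)
  have "AE \<omega> in M. Z \<omega> \<le> penalized_average S (\<theta> k \<omega>) + a (\<theta> k \<omega>) \<bullet> ?h \<omega> + r (\<theta> k \<omega>) + c"
    using Z(2) AE_norm_u[OF k] error[OF k] AE_space
  proof eventually_elim
    case (elim \<omega>)
    let ?d = "- \<alpha> *\<^sub>R (?h \<omega> + e k \<omega> + ?p (\<theta> k \<omega>))"
    have "x - y - x = - y" for x y :: "real ^ 'n" by simp
    then have d: "\<theta> (Suc k) \<omega> - \<theta> k \<omega> = ?d"
      unfolding theta_step[OF k elim(4)] scaleR_minus_left .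
    have step: "penalized_average S (\<theta> (Suc k) \<omega>) \<le>
        penalized_average S (\<theta> k \<omega>) + ?g (\<theta> k \<omega>) \<bullet> ?d + smoothness / 2 * (norm ?d)\<^sup>2"
      using penalized_average_upper_bound[OF S(1,2), of "\<theta> (Suc k) \<omega>" "\<theta> k \<omega>"]
      unfolding d smoothness_def .
    have bound: "?g (\<theta> k \<omega>) \<bullet> ?d + smoothness / 2 * (norm ?d)\<^sup>2 \<le> a (\<theta> k \<omega>) \<bullet> ?h \<omega> + r (\<theta> k \<omega>) + c"
      using descent_step_bound[OF alpha(1) smoothness norm_sphere_estimate[OF elim(2)] elim(3),
        of "?g (\<theta> k \<omega>)" "\<theta> k \<omega>" "?p (\<theta> k \<omega>)"]
      unfolding a_def r_def c_def by (simp only: add.assoc)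
    show ?case
      by (rule order_trans[OF elim(1) order_trans[OF step]]) (use bound in \<open>simp only: add.assoc add_le_cancel_left\<close>)
  qed
  \<comment> \<open>Expectations are taken only now, when neither \<open>e\<close> nor
    \<open>\<theta> (Suc k)\<close> occurs in the inequality any more.\<close>
  then have "expectation Z \<le>
      expectation (\<lambda>\<omega>. penalized_average S (\<theta> k \<omega>) + a (\<theta> k \<omega>) \<bullet> ?h \<omega> + r (\<theta> k \<omega>) + c)"
    by (intro integral_mono_AE Z(1) integrable_const Bochner_Integration.integrable_add int_F int_h int_r)
  also have "\<dots> = expectation (\<lambda>\<omega>. penalized_average S (\<theta> k \<omega>))
      + (expectation (\<lambda>\<omega>. a (\<theta> k \<omega>) \<bullet> ?s (\<theta> k \<omega>)) + expectation (\<lambda>\<omega>. r (\<theta> k \<omega>))) + c"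
    using int_F int_h int_r by (simp add: expectation_sphere_estimate[OF k a, symmetric] prob_space)
  also have "\<dots> = expectation (\<lambda>\<omega>. penalized_average S (\<theta> k \<omega>))
      + expectation (\<lambda>\<omega>. a (\<theta> k \<omega>) \<bullet> ?s (\<theta> k \<omega>) + r (\<theta> k \<omega>)) + c"
    by (simp only: Bochner_Integration.integral_add[OF int_s int_r])
  finally have "expectation Z \<le> expectation (\<lambda>\<omega>. penalized_average S (\<theta> k \<omega>))
      + expectation (\<lambda>\<omega>. a (\<theta> k \<omega>) \<bullet> ?s (\<theta> k \<omega>) + r (\<theta> k \<omega>)) + c" .
  moreover have "expectation (\<lambda>\<omega>. a (\<theta> k \<omega>) \<bullet> ?s (\<theta> k \<omega>) + r (\<theta> k \<omega>)) \<le>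
      expectation (\<lambda>\<omega>. - (\<alpha> / 2) * (norm (?g (\<theta> k \<omega>)))\<^sup>2)"
  proof (intro integral_mono)
    show "a (\<theta> k \<omega>) \<bullet> ?s (\<theta> k \<omega>) + r (\<theta> k \<omega>) \<le> - (\<alpha> / 2) * (norm (?g (\<theta> k \<omega>)))\<^sup>2" for \<omega>
      unfolding a_def r_def penalized_gradient_def by (rule descent_step_mean[OF alpha(1) smoothness])
  qed (use int_s int_r integrable_norm_gradient[OF k] in auto)
  ultimately show ?thesis by (simp add: c_def)
qed

text \<open>In each step the minorant is the penalized average at the next iterate itself. It is
  integrable for indices below \<open>K\<close>, so the telescoping stops one step short.\<close>

lemma sum_expected_gradients:
  assumes "j < K"
  shows "\<alpha> / 2 * (\<Sum>k<j. expectation (\<lambda>\<omega>. (norm (penalized_gradient S (\<theta> k \<omega>)))\<^sup>2)) \<le>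
    penalized_average S \<theta>0 - expectation (\<lambda>\<omega>. penalized_average S (\<theta> j \<omega>))
    + (\<Sum>k<j. smoothness * \<alpha>\<^sup>2 * (real CARD('n) * L)\<^sup>2 + 5 / 4 * \<alpha> * (b k)\<^sup>2)"
  using assms
proof (induction j)
  case 0
  have "expectation (\<lambda>\<omega>. penalized_average S (\<theta> 0 \<omega>)) = expectation (\<lambda>_. penalized_average S \<theta>0)"
    by (rule Bochner_Integration.integral_cong) (auto simp: theta_init(2))
  then show ?case by (simp add: prob_space)
next
  case (Suc j)
  have "integrable M (\<lambda>\<omega>. penalized_average S (\<theta> (Suc j) \<omega>))"
    by (intro integrable_theta Suc.prems continuous_on_penalized_average S)
  from expected_descent[OF Suc_lessD[OF Suc.prems] this] Suc
  show ?case by (simp add: distrib_left)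
qed

text \<open>The missing step, from index \<open>K - 1\<close> to \<open>K\<close>, is closed with
  the constant \<open>Fstar\<close> as minorant.\<close>

theorem sum_expected_gradients_bound:
  assumes "K \<ge> 1" and Fstar: "\<And>\<tau>. Fstar \<le> penalized_average S \<tau>"
  shows "\<alpha> / 2 * (\<Sum>k<K. expectation (\<lambda>\<omega>. (norm (penalized_gradient S (\<theta> k \<omega>)))\<^sup>2)) \<le>
    penalized_average S \<theta>0 - Fstar
    + real K * (smoothness * \<alpha>\<^sup>2 * (real CARD('n) * L)\<^sup>2) + 5 / 4 * \<alpha> * (\<Sum>k<K. (b k)\<^sup>2)"
proof -
  obtain j where j: "K = Suc j" using assms(1) by (cases K) auto
  have "Fstar = expectation (\<lambda>_. Fstar)" by (simp add: prob_space)
  also have "\<dots> \<le> expectation (\<lambda>\<omega>. penalized_average S (\<theta> j \<omega>))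
    - \<alpha> / 2 * expectation (\<lambda>\<omega>. (norm (penalized_gradient S (\<theta> j \<omega>)))\<^sup>2)
    + (smoothness * \<alpha>\<^sup>2 * (real CARD('n) * L)\<^sup>2 + 5 / 4 * \<alpha> * (b j)\<^sup>2)"
    by (rule expected_descent) (use Fstar j in auto)
  finally have last: "Fstar \<le> \<dots>" .
  let ?q = "smoothness * \<alpha>\<^sup>2 * (real CARD('n) * L)\<^sup>2"
  have "(\<Sum>k<j. ?q + 5 / 4 * \<alpha> * (b k)\<^sup>2) = real j * ?q + 5 / 4 * \<alpha> * (\<Sum>k<j. (b k)\<^sup>2)"
    by (simp add: sum.distrib sum_distrib_left)
  moreover have "real K * ?q = real j * ?q + ?q" by (simp add: j distrib_right)
  ultimately show ?thesis
    using sum_expected_gradients[of j] last unfolding j sum.lessThan_Suc distrib_left by linarith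
qed

end

section \<open>From the iteration back to the game\<close>

text \<open>Division by \<open>\<alpha> * K / 2\<close> gives the constants 2, 2 and 10; as all
  three terms are nonnegative, they may be relaxed to 4, 8 and 20.\<close>

lemma average_bound_from_sum:
  fixes \<alpha> K G \<Delta> c D :: real
  assumes "\<alpha> > 0" "K > 0" "\<Delta> \<ge> 0" "c \<ge> 0" "D \<ge> 0"
    and G: "\<alpha> / 2 * G \<le> \<Delta> + K * (c * \<alpha>\<^sup>2) + 5 * \<alpha> * D"
  shows "1 / K * G \<le> 4 * \<Delta> / (\<alpha> * K) + 8 * c * \<alpha> + 20 * D / K"
proof -
  have "1 / K * G = 2 / (\<alpha> * K) * (\<alpha> / 2 * G)" using assms(1,2) by simp
  also have "\<dots> \<le> 2 / (\<alpha> * K) * (\<Delta> + K * (c * \<alpha>\<^sup>2) + 5 * \<alpha> * D)"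
    using G assms(1,2) by (intro mult_left_mono) auto
  also have "\<dots> = 2 * \<Delta> / (\<alpha> * K) + 2 * c * \<alpha> + 10 * D / K"
    using assms(1,2) by (simp add: field_simps power2_eq_square)
  also have "\<dots> \<le> 4 * \<Delta> / (\<alpha> * K) + 8 * c * \<alpha> + 20 * D / K"
    using assms(1-5) by (intro add_mono divide_right_mono mult_right_mono) auto
  finally show ?thesis .
qed

text \<open>One side sums the averages of the players, the other averages the sum. The exchange
  rests on integrability of each player's objective over the ball, which follows from its Lipschitz
  bound.\<close>

lemma (in lipschitz_objective) penalized_objective_eq:
  fixes own :: "'d::finite \<Rightarrow> 'p::finite"
  assumes H: "\<And>\<tau>. H \<tau> = (\<Sum>i\<in>UNIV. player_objective own X f i \<tau>)"
    and lip_i: "\<And>i \<tau> \<tau>'. \<bar>player_objective own X f i \<tau> - player_objective own X f i \<tau>'\<bar> \<le> C * norm (\<tau> - \<tau>')"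
  shows "penalized_objective own X f S \<xi> = penalized_average S"
proof
  fix \<theta> :: "real ^ 'n"
  let ?U = "uniform_measure lborel (cball (0 :: real ^ 'n) 1)"
  interpret U: prob_space ?U by (rule prob_space_uniform_cball)
  have "norm (axis undefined 1 :: real ^ 'n) = 1" by (simp add: norm_axis_1)
  then have C: "C \<ge> 0"
    using lip_i[of undefined "axis undefined 1" 0] abs_ge_zero order_trans by fastforce
  have "integrable ?U (\<lambda>\<nu>. player_objective own X f i (\<theta> + \<xi> *\<^sub>R \<nu>))" for i
  proof -
    have "continuous_on UNIV (player_objective own X f i :: real ^ 'n \<Rightarrow> real)"
      by (rule lipschitz_on_continuous_on[where L = C]) (auto intro!: lipschitz_onI simp: dist_norm lip_i C)
    then have [measurable]: "(player_objective own X f i :: real ^ 'n \<Rightarrow> real) \<in> borel_measurable borel"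
      by (rule borel_measurable_continuous_onI)
    show ?thesis
    proof (rule U.integrable_const_bound)
      show "AE \<nu> in ?U. norm (player_objective own X f i (\<theta> + \<xi> *\<^sub>R \<nu>)) \<le> \<bar>player_objective own X f i \<theta>\<bar> + C * \<xi>"
      proof (rule AE_uniform_measureI, simp, rule AE_I2, rule impI)
        fix \<nu> :: "real ^ 'n" assume "\<nu> \<in> cball 0 1"
        then have "C * norm (\<theta> + \<xi> *\<^sub>R \<nu> - \<theta>) \<le> C * \<xi>"
          using xi by (intro mult_left_mono C) auto
        then show "norm (player_objective own X f i (\<theta> + \<xi> *\<^sub>R \<nu>)) \<le> \<bar>player_objective own X f i \<theta>\<bar> + C * \<xi>"
          using lip_i[of i "\<theta> + \<xi> *\<^sub>R \<nu>" \<theta>] by simp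
      qed
    qed simp
  qed
  then show "penalized_objective own X f S \<xi> \<theta> = penalized_average S \<theta>"
    unfolding penalized_objective_def penalized_average_def smoothed_objective_def smoothed_indicator_def H
    by (simp add: Bochner_Integration.integral_sum)
qed

context monotone_game
begin

text \<open>The decision is the same in both values, so only the dependence on the strategies
  counts; the root appears because \<open>\<epsilon>\<close> bounds a squared distance.\<close>

lemma evaluation_error:
  assumes L_x: "\<And>i x x' \<tau>. x \<in> joint_strategies own X \<Longrightarrow> x' \<in> joint_strategies own X \<Longrightarrow>
         \<bar>f i x \<tau> - f i x' \<tau>\<bar> \<le> L\<^sub>x * norm (x - x')"
    and "L\<^sub>x \<ge> 0" "x \<in> joint_strategies own X" "(norm (x - nash own X f \<tau>))\<^sup>2 \<le> \<epsilon>"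
  shows "\<bar>f i x \<tau> - player_objective own X f i \<tau>\<bar> \<le> L\<^sub>x * sqrt \<epsilon>"
proof -
  have "norm (x - nash own X f \<tau>) \<le> sqrt \<epsilon>"
    using assms(4) real_le_rsqrt by blast
  then have "L\<^sub>x * norm (x - nash own X f \<tau>) \<le> L\<^sub>x * sqrt \<epsilon>"
    using assms(2) by (rule mult_left_mono)
  then show ?thesis
    using L_x[OF assms(3) nash_in_joint_strategies, of i \<tau> \<tau>]
    unfolding player_objective_def by linarith
qed

end

theorem theorem1:
  fixes own :: "'d::finite \<Rightarrow> 'p::finite"
    and X :: "'p \<Rightarrow> (real ^ 'd) set"
    and \<Theta> :: "(real ^ 'n::finite) set"
    and f :: "'p \<Rightarrow> real ^ 'd \<Rightarrow> real ^ 'n \<Rightarrow> real"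
    and A :: "real ^ 'p ^ 'p" and E :: "('p \<times> 'p) set"
    and L\<^sub>\<theta> L\<^sub>x \<mu> l l\<^sub>\<theta> L\<^sub>F \<xi> \<alpha> \<gamma> Fstar :: real
    and \<theta>0 :: "real ^ 'n"
    and x0 :: "'p \<Rightarrow> real ^ 'd"
    and t :: "nat \<Rightarrow> nat" and \<epsilon> :: "nat \<Rightarrow> real"
    and M :: "'w measure"
    and u \<theta> :: "nat \<Rightarrow> 'w \<Rightarrow> real ^ 'n"
    and K :: nat
  \<comment> \<open>game and regulator\<close>
  assumes X_space: "\<And>i. X i \<subseteq> strategy_space own i"
    and X: "\<And>i. X i \<noteq> {} \<and> compact (X i) \<and> convex (X i)"
    and Theta: "\<Theta> \<noteq> {}" "closed \<Theta>" "convex \<Theta>"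
    and f_diff: "\<And>i x \<tau> z. (\<lambda>y. f i (deviate own i y x) \<tau>) differentiable (at z)"
    and f_C1: "\<And>i x \<tau>. continuous_on UNIV (gradient (\<lambda>y. f i (deviate own i y x) \<tau>))"
    and f_convex: "\<And>i x \<tau>. convex_on UNIV (\<lambda>y. f i (deviate own i y x) \<tau>)"
    and L_theta: "L\<^sub>\<theta> > 0"
      "\<And>i x \<tau> \<tau>'. x \<in> joint_strategies own X \<Longrightarrow> \<bar>f i x \<tau> - f i x \<tau>'\<bar> \<le> L\<^sub>\<theta> * norm (\<tau> - \<tau>')"
    and L_x: "L\<^sub>x > 0"
      "\<And>i x x' \<tau>. x \<in> joint_strategies own X \<Longrightarrow> x' \<in> joint_strategies own X \<Longrightarrow>
         \<bar>f i x \<tau> - f i x' \<tau>\<bar> \<le> L\<^sub>x * norm (x - x')"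
  \<comment> \<open>pseudo-gradient\<close>
    and G_mono: "\<mu> > 0"
      "\<And>\<tau> x x'. (pseudo_gradient own f x \<tau> - pseudo_gradient own f x' \<tau>) \<bullet> (x - x')
         \<ge> \<mu> * (norm (x - x'))\<^sup>2"
    and G_lip: "l > 0"
      "\<And>\<tau> x x'. norm (pseudo_gradient own f x \<tau> - pseudo_gradient own f x' \<tau>) \<le> l * norm (x - x')"
    and G_lip_theta: "l\<^sub>\<theta> > 0"
      "\<And>x \<tau> \<tau>'. x \<in> joint_strategies own X \<Longrightarrow>
         norm (pseudo_gradient own f x \<tau> - pseudo_gradient own f x \<tau>') \<le> l\<^sub>\<theta> * norm (\<tau> - \<tau>')"
  \<comment> \<open>communication graph\<close>
    and A_edges: "\<And>i j. if (j, i) \<in> E \<or> i = j then A $ i $ j > 0 else A $ i $ j = 0"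
    and strongly_connected: "\<And>i j. (i, j) \<in> E\<^sup>*"
    and A_stochastic: "doubly_stochastic A"
  \<comment> \<open>objectives\<close>
    and L_F: "L\<^sub>F > 0"
      "\<And>i \<tau> \<tau>'. \<bar>player_objective own X f i \<tau> - player_objective own X f i \<tau>'\<bar>
         \<le> L\<^sub>F * norm (\<tau> - \<tau>')"
    and xi: "\<xi> > 0"
    and Fstar: "\<exists>\<tau>. penalized_objective own X f \<Theta> \<xi> \<tau> = Fstar"
      "\<And>\<tau>. Fstar \<le> penalized_objective own X f \<Theta> \<xi> \<tau>"
  \<comment> \<open>algorithm\<close>
    and gamma: "\<gamma> > 0"
    and x0: "\<And>i. block own i (x0 i) \<in> X i"
    and K: "K \<ge> 1"
    and M: "prob_space M"
    and u_uniform: "\<And>k. k < K \<Longrightarrow> distr M borel (u k) = uniform_sphere"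
    and u_indep: "\<And>k. k < K \<Longrightarrow> prob_space.indep_set M (past M \<theta> u k) {u k -` B \<inter> space M | B. B \<in> sets borel}"
    and theta_init: "\<theta>0 \<in> \<Theta>" "\<And>\<omega>. \<omega> \<in> space M \<Longrightarrow> \<theta> 0 \<omega> = \<theta>0"
    and theta_step: "\<And>k \<omega>. k < K \<Longrightarrow> \<omega> \<in> space M \<Longrightarrow>
         \<theta> (Suc k) \<omega> = zo_step f \<Theta> \<xi> \<alpha> (inner_output own X f A \<gamma> x0 (t k)) (u k \<omega>) (\<theta> k \<omega>)"
    and eps: "\<And>k. k < K \<Longrightarrow> \<epsilon> k \<ge> 0"
      "\<And>k. k < K \<Longrightarrow> AE \<omega> in M. \<forall>\<tau> \<in> {\<theta> k \<omega> + \<xi> *\<^sub>R u k \<omega>, \<theta> k \<omega>}.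
         (norm (inner_output own X f A \<gamma> x0 (t k) \<tau> - nash own X f \<tau>))\<^sup>2 \<le> \<epsilon> k"
    and alpha: "\<alpha> > 0" "\<alpha> \<le> \<xi> / (4 * (real CARD('n) * real CARD('p) * L\<^sub>F + 1))"
  shows "(\<forall>k<K. integrable M (\<lambda>\<omega>. (norm (gradient (penalized_objective own X f \<Theta> \<xi>) (\<theta> k \<omega>)))\<^sup>2)) \<and>
    1 / real K * (\<Sum>k<K. prob_space.expectation M
        (\<lambda>\<omega>. (norm (gradient (penalized_objective own X f \<Theta> \<xi>) (\<theta> k \<omega>)))\<^sup>2))
    \<le> 4 * (penalized_objective own X f \<Theta> \<xi> \<theta>0 - Fstar) / (\<alpha> * real K)
      + 8 * (real CARD('p))\<^sup>2 * (real CARD('n))\<^sup>2 * L\<^sub>F\<^sup>2 * \<alpha> * ((real CARD('n) * real CARD('p) * L\<^sub>F + 1) / \<xi>)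
      + 20 * (real CARD('p))\<^sup>2 * L\<^sub>x\<^sup>2 * (real CARD('n))\<^sup>2 * (\<Sum>k<K. \<epsilon> k) / (\<xi>\<^sup>2 * real K)"
proof -
  let ?n = "real CARD('n)" and ?N = "real CARD('p)"
  define H where "H \<tau> = (\<Sum>i\<in>UNIV. player_objective own X f i \<tau>)" for \<tau>
  let ?L = "?N * L\<^sub>F"
  interpret G: monotone_game own X f \<mu> l
    using X_space X f_diff f_convex G_mono G_lip by unfold_locales
  interpret F: lipschitz_objective H ?L \<xi>
  proof
    show "\<bar>H x - H y\<bar> \<le> ?L * norm (x - y)" for x y
    proof -
      have "\<bar>H x - H y\<bar> \<le> (\<Sum>i\<in>UNIV. \<bar>player_objective own X f i x - player_objective own X f i y\<bar>)"
        unfolding H_def sum_subtractf[symmetric] by (rule sum_abs)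
      also have "\<dots> \<le> (\<Sum>i\<in>(UNIV :: 'p set). L\<^sub>F * norm (x - y))"
        by (intro sum_mono L_F(2))
      finally show ?thesis by simp
    qed
  qed (use L_F(1) xi in auto)
  interpret M: prob_space M by (rule M)
  have P: "penalized_objective own X f \<Theta> \<xi> = F.penalized_average \<Theta>"
    by (rule F.penalized_objective_eq[OF H_def L_F(2)])
  have grad: "gradient (penalized_objective own X f \<Theta> \<xi>) \<tau> = F.penalized_gradient \<Theta> \<tau>" for \<tau>
    unfolding P by (rule gradient_eqI[OF F.GDERIV_penalized_average[OF Theta(2,1,3)]])
  let ?xe = "\<lambda>k. inner_output own X f A \<gamma> x0 (t k)"
  define e where "e k \<omega> = gradient_estimate f \<xi> (?xe k) (u k \<omega>) (\<theta> k \<omega>) - F.sphere_estimate (u k \<omega>) (\<theta> k \<omega>)" for k \<omega>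
  \<comment> \<open>\<open>?N\<close> counts the players, and 2 the evaluations at the perturbed and
    at the unperturbed decision.\<close>
  define b where "b k = ?n / \<xi> * (?N * (2 * (L\<^sub>x * sqrt (\<epsilon> k))))" for k
  interpret D: inexact_descent H ?L \<xi> M \<Theta> \<theta>0 \<alpha> K u \<theta> e b
  proof
    show "\<alpha> \<le> \<xi> / (4 * (?n * ?L + 1))" using alpha(2) by (simp add: mult.assoc)
    show "\<theta> (Suc k) \<omega> = \<theta> k \<omega> - \<alpha> *\<^sub>R (F.sphere_estimate (u k \<omega>) (\<theta> k \<omega>) + e k \<omega> + F.penalty_gradient \<Theta> (\<theta> k \<omega>))"
      if "k < K" "\<omega> \<in> space M" for k \<omega>
      using theta_step[OF that] by (simp add: zo_step_def e_def F.penalty_gradient_def)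
    show "AE \<omega> in M. norm (u k \<omega>) = 1 \<longrightarrow> norm (e k \<omega>) \<le> b k" if k: "k < K" for k
      using eps(2)[OF k]
    proof eventually_elim
      case (elim \<omega>)
      show ?case
      proof
        assume u: "norm (u k \<omega>) = 1"
        let ?\<tau> = "\<theta> k \<omega>" and ?\<tau>' = "\<theta> k \<omega> + \<xi> *\<^sub>R u k \<omega>"
        let ?\<delta> = "\<lambda>i \<tau>. f i (?xe k \<tau>) \<tau> - player_objective own X f i \<tau>"
        have \<delta>: "\<bar>?\<delta> i \<tau>\<bar> \<le> L\<^sub>x * sqrt (\<epsilon> k)" if "\<tau> \<in> {?\<tau>', ?\<tau>}" for i \<tau>
          using elim that L_x(1)
          by (intro G.evaluation_error[OF L_x(2)] G.inner_output_in_joint_strategies x0) auto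
        \<comment> \<open>All players' values multiply the same direction, so the error is one
          scalar times \<open>u k \<omega>\<close>.\<close>
        have "e k \<omega> = (?n / \<xi> * (\<Sum>i\<in>UNIV. ?\<delta> i ?\<tau>' - ?\<delta> i ?\<tau>)) *\<^sub>R u k \<omega>"
          unfolding e_def gradient_estimate_def F.sphere_estimate_def H_def scaleR_sum_left[symmetric]
            scaleR_diff_left[symmetric] sum_distrib_left[symmetric] right_diff_distrib[symmetric] sum_subtractf
          by (simp add: algebra_simps)
        then have "norm (e k \<omega>) = ?n / \<xi> * \<bar>\<Sum>i\<in>UNIV. ?\<delta> i ?\<tau>' - ?\<delta> i ?\<tau>\<bar>"
          using u xi by (simp add: abs_mult)
        also have "\<dots> \<le> ?n / \<xi> * (?N * (2 * (L\<^sub>x * sqrt (\<epsilon> k))))"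
        proof (intro mult_left_mono)
          have "\<bar>\<Sum>i\<in>UNIV. ?\<delta> i ?\<tau>' - ?\<delta> i ?\<tau>\<bar> \<le> (\<Sum>i\<in>(UNIV :: 'p set). 2 * (L\<^sub>x * sqrt (\<epsilon> k)))"
          proof (rule order_trans[OF sum_abs sum_mono])
            show "\<bar>?\<delta> i ?\<tau>' - ?\<delta> i ?\<tau>\<bar> \<le> 2 * (L\<^sub>x * sqrt (\<epsilon> k))" for i
              using \<delta>[of ?\<tau>' i] \<delta>[of ?\<tau> i] abs_triangle_ineq4[of "?\<delta> i ?\<tau>'" "?\<delta> i ?\<tau>"] by simp
          qed
          then show "\<bar>\<Sum>i\<in>UNIV. ?\<delta> i ?\<tau>' - ?\<delta> i ?\<tau>\<bar> \<le> ?N * (2 * (L\<^sub>x * sqrt (\<epsilon> k)))" by simp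
        qed (use xi in simp)
        finally show "norm (e k \<omega>) \<le> b k" unfolding b_def .
      qed
    qed
  qed (use Theta alpha(1) u_uniform u_indep theta_init in auto)
  \<comment> \<open>The 4 is the square of the 2 in \<open>b\<close>; multiplied by the 5/4 of the
    step bound it gives the 5 in \<open>average_bound_from_sum\<close>.\<close>
  have b: "(\<Sum>k<K. (b k)\<^sup>2) = 4 * (?N\<^sup>2 * L\<^sub>x\<^sup>2 * ?n\<^sup>2 * (\<Sum>k<K. \<epsilon> k) / \<xi>\<^sup>2)"
    unfolding sum_distrib_left sum_divide_distrib
    by (rule sum.cong) (auto simp: b_def power_mult_distrib power_divide eps(1))
  have "1 / real K * (\<Sum>k<K. M.expectation (\<lambda>\<omega>. (norm (F.penalized_gradient \<Theta> (\<theta> k \<omega>)))\<^sup>2)) \<le>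
      4 * (F.penalized_average \<Theta> \<theta>0 - Fstar) / (\<alpha> * real K) + 8 * (D.smoothness * (?n * ?L)\<^sup>2) * \<alpha>
      + 20 * (?N\<^sup>2 * L\<^sub>x\<^sup>2 * ?n\<^sup>2 * (\<Sum>k<K. \<epsilon> k) / \<xi>\<^sup>2) / real K"
  proof (rule average_bound_from_sum)
    show "\<alpha> / 2 * (\<Sum>k<K. M.expectation (\<lambda>\<omega>. (norm (F.penalized_gradient \<Theta> (\<theta> k \<omega>)))\<^sup>2)) \<le>
      F.penalized_average \<Theta> \<theta>0 - Fstar + real K * (D.smoothness * (?n * ?L)\<^sup>2 * \<alpha>\<^sup>2)
      + 5 * \<alpha> * (?N\<^sup>2 * L\<^sub>x\<^sup>2 * ?n\<^sup>2 * (\<Sum>k<K. \<epsilon> k) / \<xi>\<^sup>2)"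
      using D.sum_expected_gradients_bound[OF K Fstar(2)[unfolded P]] unfolding b
      by (simp add: mult_ac)
    show "0 \<le> F.penalized_average \<Theta> \<theta>0 - Fstar" using Fstar(2)[of \<theta>0] by (simp add: P)
    show "0 \<le> D.smoothness * (?n * ?L)\<^sup>2" using D.smoothness(1) by simp
    show "0 \<le> ?N\<^sup>2 * L\<^sub>x\<^sup>2 * ?n\<^sup>2 * (\<Sum>k<K. \<epsilon> k) / \<xi>\<^sup>2"
      using eps(1) by (intro divide_nonneg_nonneg mult_nonneg_nonneg sum_nonneg) auto
  qed (use alpha(1) K in auto)
  also have "8 * (D.smoothness * (?n * ?L)\<^sup>2) * \<alpha> = 8 * ?N\<^sup>2 * ?n\<^sup>2 * L\<^sub>F\<^sup>2 * \<alpha> * ((?n * ?N * L\<^sub>F + 1) / \<xi>)"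
    unfolding D.smoothness_def by (simp add: power_mult_distrib mult_ac)
  also have "20 * (?N\<^sup>2 * L\<^sub>x\<^sup>2 * ?n\<^sup>2 * (\<Sum>k<K. \<epsilon> k) / \<xi>\<^sup>2) / real K =
      20 * ?N\<^sup>2 * L\<^sub>x\<^sup>2 * ?n\<^sup>2 * (\<Sum>k<K. \<epsilon> k) / (\<xi>\<^sup>2 * real K)"
    by simp
  finally show ?thesis
    unfolding grad P[symmetric] using D.integrable_norm_gradient by blast
qed

end
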